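(* Consider the setting described in the context, and assume A1–A5. Let $f_n=\sum_{j\ge1}\theta_{nj}\phi_j$ be a sequence in $\mathbb{L}_2(0,1)$ with $cn^{-r}\le\|f_n\|\le Cn^{-r}$ for constants $0<c<C$. Then the sequence of alternatives $f_n$ is consistent if and only if there are constants $c_1>0$, $c_2>0$ and $n_0$ such that $$\sum_{j<c_2k_n}\theta_{nj}^2>c_1n^{-2r}\quad\text{for all } n>n_0 .$$
   Context: Fix $\sigma>0$, $0<r<1/2$ and an orthonormal basis $(\phi_j)_{j\ge1}$ of $\mathbb{L}_2(0,1)$. For each $n$ one observes $dY_n(t)=f(t)\,dt+\sigma n^{-1/2}dw(t)$, $t\in[0,1]$ ($w$ standard Wiener process, $f\in\mathbb{L}_2(0,1)$ unknown), equivalently $y_j=\theta_j+\sigma n^{-1/2}\xi_j$ with $\theta_j=\int_0^1f\phi_j$, $\xi_j$ i.i.d. $N(0,1)$. The hypothesis is $H_0: f=0$. For each $n$ nonnegative weights $\kappa_{nj}^2$, $j\ge1$, are given, $\rho_n=\sum_j\kappa_{nj}^2<\infty$, and the test statistic is $T_n(Y_n)=\sum_j\kappa_{nj}^2y_j^2-\sigma^2n^{-1}\rho_n$. Put $k_n=\sup\{k:\sum_{j<k}\kappa_{nj}^2\le\rho_n/2\}$ and $\kappa_n^2=\kappa_{nk_n}^2$. Assumptions: (A1) for each $n$, $j\mapsto\kappa_{nj}^2$ is decreasing; (A2) there are $C_1,C_2>0$ with $C_1<A_n:=\sigma^{-4}n^2\sum_j\kappa_{nj}^4<C_2$ for all $n$;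 (A3) $c_1n^{-2r}\le\rho_n\le c_2n^{-2r}$ for some $c_1,c_2>0$; (A4) there are $C_1>0$ and $\lambda>1$ such that for every $\delta>0$ and every $n$, $\kappa^2_{n,[(1+\delta)k_n]}<C_1(1+\delta)^{-\lambda}\kappa_n^2$; (A5) $\kappa_{n1}^2\asymp\kappa_n^2$, and for every $c>1$ there is $C>0$ with $\kappa^2_{n,[ck_n]}\ge C\kappa_n^2$ for all $n$. A test generated by $T_n$ rejects $H_0$ iff $T_n(Y_n)$ exceeds a threshold; $\alpha(K)$ is its type I error probability and $\beta(K,f)$ its type II error probability at $f$. A sequence $f_n$ is consistent if for every $\alpha\in(0,1)$ and every sequence of tests $K_n$ generated by $T_n$ with $\alpha(K_n)=\alpha(1+o(1))$ one has $\limsup_n\beta(K_n,f_n)<1-\alpha$. Here $a_n\asymp b_n$ means $c<a_n/b_n<C$ for all $n$, and $[a]$ is the integer part. *)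

theory Defs
  imports "HOL-Probability.Probability"
begin

text \<open>Coordinates are indexed by j \<ge> 1 (index 0 is unused throughout).
  A function f in L2(0,1) is identified with its coefficient sequence
  theta j = <f, phi j>, j \<ge> 1, w.r.t. the fixed orthonormal basis, so that
  the L2 norm of f is the l2 norm of theta (Parseval).\<close>

definition xi_space :: "(nat \<Rightarrow> real) measure" where
  "xi_space = PiM UNIV (\<lambda>_. density lborel std_normal_density)"

definition rho :: "(nat \<Rightarrow> nat \<Rightarrow> real) \<Rightarrow> nat \<Rightarrow> real" where
  "rho \<kappa>2 n = (\<Sum>i. \<kappa>2 n (Suc i))"

definition obs :: "real \<Rightarrow> nat \<Rightarrow> (nat \<Rightarrow> real) \<Rightarrow> (nat \<Rightarrow> real) \<Rightarrow> (nat \<Rightarrow> real)" where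
  "obs \<sigma> n \<theta> \<xi> = (\<lambda>j. \<theta> j + \<sigma> / sqrt (real n) * \<xi> j)"

definition Tstat :: "(nat \<Rightarrow> nat \<Rightarrow> real) \<Rightarrow> real \<Rightarrow> nat \<Rightarrow> (nat \<Rightarrow> real) \<Rightarrow> real" where
  "Tstat \<kappa>2 \<sigma> n y = (\<Sum>i. \<kappa>2 n (Suc i) * (y (Suc i))\<^sup>2) - \<sigma>\<^sup>2 / real n * rho \<kappa>2 n"

definition kn :: "(nat \<Rightarrow> nat \<Rightarrow> real) \<Rightarrow> nat \<Rightarrow> nat" where
  "kn \<kappa>2 n = Sup {k. (\<Sum>j\<in>{1..<k}. \<kappa>2 n j) \<le> rho \<kappa>2 n / 2}"

definition kappa_n :: "(nat \<Rightarrow> nat \<Rightarrow> real) \<Rightarrow> nat \<Rightarrow> real" where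
  "kappa_n \<kappa>2 n = \<kappa>2 n (kn \<kappa>2 n)"

definition alpha_err :: "(nat \<Rightarrow> nat \<Rightarrow> real) \<Rightarrow> real \<Rightarrow> nat \<Rightarrow> real \<Rightarrow> real" where
  "alpha_err \<kappa>2 \<sigma> n t =
     measure xi_space {\<xi> \<in> space xi_space. Tstat \<kappa>2 \<sigma> n (obs \<sigma> n (\<lambda>_. 0) \<xi>) > t}"

definition beta_err :: "(nat \<Rightarrow> nat \<Rightarrow> real) \<Rightarrow> real \<Rightarrow> nat \<Rightarrow> real \<Rightarrow> (nat \<Rightarrow> real) \<Rightarrow> real" where
  "beta_err \<kappa>2 \<sigma> n t \<theta> =
     measure xi_space {\<xi> \<in> space xi_space. Tstat \<kappa>2 \<sigma> n (obs \<sigma> n \<theta> \<xi>) \<le> t}"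

text \<open>Consistency of a sequence of alternatives (given by coefficient sequences).
  alpha(K_n) = alpha (1 + o(1)) is rendered as alpha(K_n)/alpha \<longrightarrow> 1.\<close>
definition consistent :: "(nat \<Rightarrow> nat \<Rightarrow> real) \<Rightarrow> real \<Rightarrow> (nat \<Rightarrow> nat \<Rightarrow> real) \<Rightarrow> bool" where
  "consistent \<kappa>2 \<sigma> \<theta>s \<longleftrightarrow>
     (\<forall>\<alpha>. 0 < \<alpha> \<and> \<alpha> < 1 \<longrightarrow>
       (\<forall>t :: nat \<Rightarrow> real.
          ((\<lambda>n. alpha_err \<kappa>2 \<sigma> n (t n) / \<alpha>) \<longlonglongrightarrow> 1) \<longrightarrow>
          limsup (\<lambda>n. ereal (beta_err \<kappa>2 \<sigma> n (t n) (\<theta>s n))) < ereal (1 - \<alpha>)))"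

end

theory Submission
  imports Defs
begin

text \<open>
  Divided by its null standard deviation, \<^term>\<open>Tstat\<close> is the sum of a centred weighted chi-square
  variable \<open>Z\<close>, the signal \<open>s = \<Sum>\<^sub>j a\<^sub>j h\<^sub>j\<^sup>2\<close> and a cross term of variance at most \<open>4 a\<^sub>1 s\<close>.
  The assumptions force the rescaled weights \<open>a\<^sub>j\<close> to vanish uniformly, so \<open>Z\<close> is asymptotically normal
  (estimate its characteristic function and apply Levy's continuity theorem) and the cross term is
  negligible against \<open>s\<close>. Hence consistency means exactly that the signal stays bounded away from 0.
  Since \<open>\<rho>\<^sub>n \<kappa>\<^sub>n\<^sup>2\<close> and \<open>\<Sum>\<^sub>j \<kappa>\<^sub>n\<^sub>j\<^sup>4\<close> have the same order, \<open>\<kappa>\<^sub>n\<^sup>2\<close> has order \<open>n\<close> to the power \<open>2r - 2\<close>; the weights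
  are comparable to \<open>\<kappa>\<^sub>n\<^sup>2\<close> for \<open>j < c\<^sub>2 k\<^sub>n\<close> and much smaller beyond for large \<open>c\<^sub>2\<close>, so the signal is
  controlled by the energy of the coefficients with \<open>j < c\<^sub>2 k\<^sub>n\<close>.
\<close>

section \<open>The Gaussian sequence space\<close>

lemma prob_space_xi_space: "prob_space xi_space"
  unfolding xi_space_def
  by (intro prob_space_PiM prob_space_normal_density) simp

interpretation xi: prob_space xi_space
  by (rule prob_space_xi_space)

lemma measurable_xi_component [measurable]: "(\<lambda>\<xi>. \<xi> j) \<in> borel_measurable xi_space"
proof -
  have "(\<lambda>\<xi>. \<xi> j) \<in> measurable xi_space std_normal_distribution"
    unfolding xi_space_def by (rule measurable_component_singleton) simp
  then show ?thesis
    by (simp add: measurable_def)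
qed

lemma distr_xi_component: "distr xi_space borel (\<lambda>\<xi>. \<xi> j) = std_normal_distribution"
proof -
  interpret product_prob_space "\<lambda>_. std_normal_distribution" "UNIV :: nat set"
    by (intro product_prob_spaceI prob_space_normal_density) simp
  have "distr xi_space borel (\<lambda>\<xi>. \<xi> j) = distr xi_space std_normal_distribution (\<lambda>\<xi>. \<xi> j)"
    by (rule distr_cong) auto
  also have "\<dots> = std_normal_distribution"
    unfolding xi_space_def by (rule PiM_component) simp
  finally show ?thesis .
qed

text \<open>The joint law of all coordinates is \<open>xi_space\<close> itself, which by
  construction is the product of its one-dimensional marginals. This is the distributional criterion
  for independence.\<close>

lemma indep_vars_xi: "xi.indep_vars (\<lambda>_. borel) (\<lambda>j \<xi>. \<xi> j) UNIV"
proof (subst xi.indep_vars_iff_distr_eq_PiM)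
  have "distr xi_space (PiM UNIV (\<lambda>_. borel)) (\<lambda>\<xi>. \<lambda>i\<in>UNIV. \<xi> i) = distr xi_space xi_space (\<lambda>\<xi>. \<xi>)"
    by (intro distr_cong refl) (auto simp: xi_space_def intro!: sets_PiM_cong)
  then show "distr xi_space (PiM UNIV (\<lambda>_. borel)) (\<lambda>\<xi>. \<lambda>i\<in>UNIV. \<xi> i) =
      PiM UNIV (\<lambda>i. distr xi_space borel (\<lambda>\<xi>. \<xi> i))"
    by (simp add: distr_xi_component) (simp add: xi_space_def)
qed auto

lemma integral_xi_component:
  fixes f :: "real \<Rightarrow> 'a::{banach, second_countable_topology}"
  assumes [measurable]: "f \<in> borel_measurable borel"
  shows "(\<integral>\<xi>. f (\<xi> j) \<partial>xi_space) = (\<integral>x. f x \<partial>std_normal_distribution)"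
  by (subst distr_xi_component[of j, symmetric], subst integral_distr) auto

lemma integrable_xi_component:
  fixes f :: "real \<Rightarrow> 'a::{banach, second_countable_topology}"
  assumes [measurable]: "f \<in> borel_measurable borel"
  shows "integrable xi_space (\<lambda>\<xi>. f (\<xi> j)) \<longleftrightarrow> integrable std_normal_distribution f"
  by (subst distr_xi_component[of j, symmetric], subst integrable_distr_eq) auto

lemma integrable_xi_power: "integrable xi_space (\<lambda>\<xi>. \<xi> j ^ k)"
  by (subst integrable_xi_component) (auto intro: integrable_std_normal_distribution_moment)

lemma std_normal_second_moment: "(\<integral>x. x\<^sup>2 \<partial>std_normal_distribution) = (1::real)"
  using std_normal_distribution_even_moments(1)[of 1] by (simp add: fact_numeral)

lemma std_normal_fourth_moment: "(\<integral>x. x ^ 4 \<partial>std_normal_distribution) = (3::real)"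
  using std_normal_distribution_even_moments(1)[of 2] by (simp add: fact_numeral)

section \<open>Almost sure convergence and second moments of Gaussian series\<close>

text \<open>Each squared coordinate has mean 1, so by monotone convergence the series has
  expectation \<open>suminf a\<close>, which is finite, and hence is finite almost surely. Infinite
  sums can be split or rescaled only where they converge, so every later identity between series
  rests on this.\<close>

lemma AE_summable_weighted_squares:
  fixes a :: "nat \<Rightarrow> real"
  assumes nonneg: "\<And>i. 0 \<le> a i" and sm: "summable a"
  shows "AE \<xi> in xi_space. summable (\<lambda>i. a i * (\<xi> (Suc i))\<^sup>2)"
proof -
  have int: "(\<integral>\<^sup>+\<xi>. ennreal (a i * (\<xi> (Suc i))\<^sup>2) \<partial>xi_space) = ennreal (a i)" for i
  proof -
    have "(\<integral>\<^sup>+\<xi>. ennreal (a i * (\<xi> (Suc i))\<^sup>2) \<partial>xi_space) = ennreal (\<integral>\<xi>. a i * (\<xi> (Suc i))\<^sup>2 \<partial>xi_space)"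
      using nonneg by (intro nn_integral_eq_integral) (auto intro!: integrable_xi_power)
    also have "(\<integral>\<xi>. a i * (\<xi> (Suc i))\<^sup>2 \<partial>xi_space) = a i"
      using integral_xi_component[of "\<lambda>x. x\<^sup>2" "Suc i"] by (simp add: std_normal_second_moment)
    finally show ?thesis .
  qed
  have "(\<integral>\<^sup>+\<xi>. (\<Sum>i. ennreal (a i * (\<xi> (Suc i))\<^sup>2)) \<partial>xi_space) = (\<Sum>i. ennreal (a i))"
    by (subst nn_integral_suminf) (auto simp: int)
  also have "\<dots> \<noteq> \<infinity>"
    using suminf_ennreal2[OF nonneg sm] by simp
  finally have "AE \<xi> in xi_space. (\<Sum>i. ennreal (a i * (\<xi> (Suc i))\<^sup>2)) \<noteq> \<infinity>"
    by (intro nn_integral_PInf_AE) auto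
  then show ?thesis
    by eventually_elim (rule summable_suminf_not_top, use nonneg in auto)
qed

lemma integral_xi_product:
  "(\<integral>\<xi>. \<xi> i * \<xi> j \<partial>xi_space) = (if i = j then 1 else 0)"
proof (cases "i = j")
  case True
  then show ?thesis
    using integral_xi_component[of "\<lambda>x. x\<^sup>2" i] std_normal_second_moment
    by (simp add: power2_eq_square)
next
  case False
  have m: "(\<integral>\<xi>. \<xi> k \<partial>xi_space) = 0" for k
    using integral_xi_component[of "\<lambda>x. x" k] integral_std_normal_distribution_moment_odd[of 1] by simp
  have "(\<integral>\<xi>. (\<Prod>k\<in>{i,j}. \<xi> k) \<partial>xi_space) = (\<Prod>k\<in>{i,j}. \<integral>\<xi>. \<xi> k \<partial>xi_space)"
    using integrable_xi_power[of _ 1]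
    by (intro xi.indep_vars_lebesgue_integral xi.indep_vars_subset[OF indep_vars_xi]) auto
  with False show ?thesis
    by (simp add: m)
qed

lemma integrable_xi_product: "integrable xi_space (\<lambda>\<xi>. \<xi> i * \<xi> j)"
proof (rule Bochner_Integration.integrable_bound)
  show "integrable xi_space (\<lambda>\<xi>. (\<xi> i)\<^sup>2 + (\<xi> j)\<^sup>2)"
    by (intro Bochner_Integration.integrable_add integrable_xi_power)
  have "\<bar>x * y\<bar> \<le> x\<^sup>2 + y\<^sup>2" for x y :: real
  proof -
    have "0 \<le> (\<bar>x\<bar> - \<bar>y\<bar>)\<^sup>2" by simp
    then have "2 * \<bar>x * y\<bar> \<le> x\<^sup>2 + y\<^sup>2"
      by (simp add: power2_diff abs_mult)
    then show ?thesis by linarith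
  qed
  then show "AE \<xi> in xi_space. norm (\<xi> i * \<xi> j) \<le> norm ((\<xi> i)\<^sup>2 + (\<xi> j)\<^sup>2)"
    by (auto intro: order_trans)
qed auto

text \<open>The coordinates are orthonormal in the L2 space of the noise, so the off-diagonal terms
  of the expanded square integrate to 0. The nonnegative integral is the form to which Fatou's lemma
  applies next.\<close>

lemma second_moment_linear_form:
  fixes b :: "nat \<Rightarrow> real"
  shows "(\<integral>\<^sup>+\<xi>. ennreal ((\<Sum>i<N. b i * \<xi> (Suc i))\<^sup>2) \<partial>xi_space) = ennreal (\<Sum>i<N. (b i)\<^sup>2)"
proof -
  have eq: "(\<Sum>i<N. b i * \<xi> (Suc i))\<^sup>2 = (\<Sum>i<N. \<Sum>j<N. (b i * b j) * (\<xi> (Suc i) * \<xi> (Suc j)))" for \<xi>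
    by (simp add: power2_eq_square sum_product algebra_simps)
  have "(\<integral>\<^sup>+\<xi>. ennreal ((\<Sum>i<N. b i * \<xi> (Suc i))\<^sup>2) \<partial>xi_space) =
      ennreal (\<integral>\<xi>. (\<Sum>i<N. b i * \<xi> (Suc i))\<^sup>2 \<partial>xi_space)"
  proof (rule nn_integral_eq_integral)
    show "integrable xi_space (\<lambda>\<xi>. (\<Sum>i<N. b i * \<xi> (Suc i))\<^sup>2)"
      unfolding eq by (intro Bochner_Integration.integrable_sum integrable_mult_right integrable_xi_product)
  qed simp
  also have "(\<integral>\<xi>. (\<Sum>i<N. b i * \<xi> (Suc i))\<^sup>2 \<partial>xi_space) =
      (\<Sum>i<N. \<Sum>j<N. (b i * b j) * (if i = j then 1 else 0))"
    unfolding eq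
    by (subst Bochner_Integration.integral_sum, (intro Bochner_Integration.integrable_sum integrable_mult_right integrable_xi_product),
        subst Bochner_Integration.integral_sum, (intro integrable_mult_right integrable_xi_product))
       (simp add: integral_xi_product)
  also have "\<dots> = (\<Sum>i<N. (b i)\<^sup>2)"
    by (simp add: power2_eq_square if_distrib cong: if_cong)
  finally show ?thesis .
qed

text \<open>Chebyshev's inequality for an infinite linear form. Fatou's lemma carries the second
  moments of the partial sums over to the almost sure limit; the resulting inequality, rather than
  an equality, is enough.\<close>

lemma linear_form_tail_bound:
  fixes b :: "nat \<Rightarrow> real"
  assumes conv: "AE \<xi> in xi_space. summable (\<lambda>i. b i * \<xi> (Suc i))"
    and sq: "summable (\<lambda>i. (b i)\<^sup>2)" and \<delta>: "0 < \<delta>"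
  shows "measure xi_space {\<xi> \<in> space xi_space. \<delta> \<le> \<bar>\<Sum>i. b i * \<xi> (Suc i)\<bar>} \<le> (\<Sum>i. (b i)\<^sup>2) / \<delta>\<^sup>2"
proof -
  let ?X = "\<lambda>\<xi>. \<Sum>i. b i * \<xi> (Suc i)" and ?S = "\<lambda>N \<xi>. \<Sum>i<N. b i * \<xi> (Suc i)"
  have "(\<integral>\<^sup>+\<xi>. ennreal ((?X \<xi>)\<^sup>2) \<partial>xi_space) = (\<integral>\<^sup>+\<xi>. liminf (\<lambda>N. ennreal ((?S N \<xi>)\<^sup>2)) \<partial>xi_space)"
  proof (rule nn_integral_cong_AE)
    show "AE \<xi> in xi_space. ennreal ((?X \<xi>)\<^sup>2) = liminf (\<lambda>N. ennreal ((?S N \<xi>)\<^sup>2))"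
      using conv
    proof eventually_elim
      case (elim \<xi>)
      then have "(\<lambda>N. ?S N \<xi>) \<longlonglongrightarrow> ?X \<xi>"
        by (rule summable_LIMSEQ)
      then have "(\<lambda>N. ennreal ((?S N \<xi>)\<^sup>2)) \<longlonglongrightarrow> ennreal ((?X \<xi>)\<^sup>2)"
        by (intro tendsto_intros)
      then show ?case
        by (intro lim_imp_Liminf[symmetric]) simp_all
    qed
  qed
  also have "\<dots> \<le> liminf (\<lambda>N. \<integral>\<^sup>+\<xi>. ennreal ((?S N \<xi>)\<^sup>2) \<partial>xi_space)"
    by (rule nn_integral_liminf) auto
  also have "\<dots> = ennreal (\<Sum>i. (b i)\<^sup>2)"
    unfolding second_moment_linear_form
    by (intro lim_imp_Liminf tendsto_intros summable_LIMSEQ sq) simp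
  finally have E: "(\<integral>\<^sup>+\<xi>. ennreal ((?X \<xi>)\<^sup>2) \<partial>xi_space) \<le> ennreal (\<Sum>i. (b i)\<^sup>2)" .
  \<comment> \<open>The event is squared and rescaled to the shape "1 is at most a constant times a
    nonnegative function", in which Markov's inequality is stated.\<close>
  have "emeasure xi_space {\<xi> \<in> space xi_space. \<delta> \<le> \<bar>?X \<xi>\<bar>} =
      emeasure xi_space ({\<xi> \<in> space xi_space. 1 \<le> ennreal (1 / \<delta>\<^sup>2) * ennreal ((?X \<xi>)\<^sup>2)} \<inter> space xi_space)"
  proof (intro arg_cong[where f = "emeasure xi_space"] set_eqI)
    fix \<xi>
    have "\<delta> \<le> \<bar>?X \<xi>\<bar> \<longleftrightarrow> \<delta>\<^sup>2 \<le> (?X \<xi>)\<^sup>2"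
      using \<delta> by (simp add: abs_le_square_iff[symmetric])
    also have "\<dots> \<longleftrightarrow> 1 \<le> 1 / \<delta>\<^sup>2 * (?X \<xi>)\<^sup>2"
      using \<delta> by (simp add: field_simps)
    finally show "\<xi> \<in> {\<xi> \<in> space xi_space. \<delta> \<le> \<bar>?X \<xi>\<bar>} \<longleftrightarrow>
        \<xi> \<in> {\<xi> \<in> space xi_space. 1 \<le> ennreal (1 / \<delta>\<^sup>2) * ennreal ((?X \<xi>)\<^sup>2)} \<inter> space xi_space"
      by (simp add: ennreal_mult'[symmetric] ennreal_1[symmetric] del: ennreal_1)
  qed
  also have "\<dots> \<le> ennreal (1 / \<delta>\<^sup>2) * (\<integral>\<^sup>+\<xi>. ennreal ((?X \<xi>)\<^sup>2) * indicator (space xi_space) \<xi> \<partial>xi_space)"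
    by (rule order_trans[OF _ nn_integral_Markov_inequality]) (auto intro!: emeasure_mono)
  also have "\<dots> = ennreal (1 / \<delta>\<^sup>2) * (\<integral>\<^sup>+\<xi>. ennreal ((?X \<xi>)\<^sup>2) \<partial>xi_space)"
    by (intro arg_cong2[where f="(*)"] nn_integral_cong) auto
  also have "\<dots> \<le> ennreal (1 / \<delta>\<^sup>2) * ennreal (\<Sum>i. (b i)\<^sup>2)"
    by (intro mult_left_mono E) auto
  also have "\<dots> = ennreal ((\<Sum>i. (b i)\<^sup>2) / \<delta>\<^sup>2)"
    by (subst ennreal_mult'[symmetric]) (auto intro: suminf_nonneg sq)
  finally show ?thesis
    by (simp add: xi.emeasure_eq_measure suminf_nonneg sq divide_nonneg_nonneg)
qed

section \<open>The central limit theorem for weighted sums of squares\<close>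

text \<open>This law has mean 0 and variance 2. Hence weights whose squares sum to 1/2 produce unit
  variance, the normalisation used from here on.\<close>

abbreviation centered_chisq :: "real measure" where
  "centered_chisq \<equiv> distr std_normal_distribution borel (\<lambda>x. x\<^sup>2 - 1)"

text \<open>Both bounds come from \<open>1 + y \<le> exp y\<close>: at \<open>y = - x\<close> for
  the lower one, and at \<open>y = x\<close>, inverted, for the upper one, where
  \<open>(1 - x + x^2) * (1 + x) = 1 + x^3\<close> is at least 1.\<close>

lemma exp_minus_approx:
  fixes x :: real
  assumes "0 \<le> x"
  shows "\<bar>exp (- x) - (1 - x)\<bar> \<le> x\<^sup>2"
proof -
  have 1: "1 - x \<le> exp (- x)"
    using exp_ge_add_one_self[of "- x"] by simp
  have "exp (- x) \<le> 1 / (1 + x)"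
    using exp_ge_add_one_self[of x] assms by (simp add: exp_minus field_simps)
  also have "\<dots> \<le> 1 - x + x\<^sup>2"
  proof -
    have "1 \<le> (1 - x + x\<^sup>2) * (1 + x)"
      using assms by (simp add: algebra_simps power2_eq_square)
    then show ?thesis
      using assms by (simp add: pos_divide_le_eq)
  qed
  finally show ?thesis using 1 by simp
qed

lemma real_distribution_centered_chisq: "real_distribution centered_chisq"
proof -
  interpret real_distribution std_normal_distribution by (rule real_dist_normal_dist)
  show ?thesis by (rule real_distribution_distr) simp
qed

text \<open>With mean 0 and variance 2 the second-order Taylor polynomial of the characteristic
  function is \<open>1 - t^2\<close>, with an error governed by the third absolute moment. Replacing
  \<open>1 - t^2\<close> by \<open>exp (- t^2)\<close> costs at most \<open>t^4\<close>; the
  exponential form makes the comparison multiplicative over independent summands.\<close>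

lemma char_centered_chisq_approx:
  "\<exists>K\<ge>0. \<forall>t. cmod (char centered_chisq t - exp (- t\<^sup>2)) \<le> K * \<bar>t\<bar> ^ 3 + t ^ 4"
proof -
  interpret N: real_distribution std_normal_distribution by (rule real_dist_normal_dist)
  interpret D: real_distribution centered_chisq by (rule real_distribution_centered_chisq)
  note mom = integrable_std_normal_distribution_moment
  have i1: "integrable centered_chisq (\<lambda>x. x)"
    by (subst integrable_distr_eq) (auto intro!: mom)
  have e1: "D.expectation (\<lambda>x. x) = 0"
  proof -
    have "D.expectation (\<lambda>x. x) = N.expectation (\<lambda>x. x\<^sup>2 - 1)"
      by (subst integral_distr) auto
    also have "\<dots> = 0"
      using mom[of 2] N.prob_space by (simp add: std_normal_second_moment)
    finally show ?thesis .
  qed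
  have pw: "(x\<^sup>2 - 1)\<^sup>2 = x ^ 4 - 2 * x\<^sup>2 + 1" for x :: real
    by (simp add: power2_eq_square power4_eq_xxxx algebra_simps)
  have i2: "integrable centered_chisq (\<lambda>x. x\<^sup>2)"
  proof (subst integrable_distr_eq)
    show "integrable std_normal_distribution (\<lambda>x. (x\<^sup>2 - 1)\<^sup>2)"
      unfolding pw
      by (intro Bochner_Integration.integrable_add Bochner_Integration.integrable_diff
          integrable_mult_right mom) auto
  qed auto
  have e2: "D.variance (\<lambda>x. x) = 2"
  proof -
    have "D.variance (\<lambda>x. x) = D.expectation (\<lambda>x. x\<^sup>2)"
      by (simp add: e1)
    also have "\<dots> = N.expectation (\<lambda>x. x ^ 4 - 2 * x\<^sup>2 + 1)"
      by (subst integral_distr) (auto simp: pw)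
    also have "\<dots> = 2"
      using mom[of 2] mom[of 4] N.prob_space
      by (simp add: std_normal_second_moment std_normal_fourth_moment)
    finally show ?thesis .
  qed
  have i3: "integrable centered_chisq (\<lambda>x. \<bar>x\<bar> ^ 3)"
  proof (subst integrable_distr_eq)
    have pw3: "(x\<^sup>2 - 1) ^ 3 = x ^ 6 - 3 * x ^ 4 + 3 * x\<^sup>2 - 1" for x :: real
      by algebra
    have "integrable std_normal_distribution (\<lambda>x. (x\<^sup>2 - 1) ^ 3)"
      unfolding pw3
      by (intro Bochner_Integration.integrable_add Bochner_Integration.integrable_diff
          integrable_mult_right mom) auto
    from integrable_norm[OF this]
    show "integrable std_normal_distribution (\<lambda>x. \<bar>x\<^sup>2 - 1\<bar> ^ 3)"
      by (simp add: power_abs)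
  qed auto
  \<comment> \<open>One sixth of the third absolute moment: the constant left when the minimum in
    the Taylor remainder is bounded by its second argument.\<close>
  define K where "K = D.expectation (\<lambda>x. \<bar>x\<bar> ^ 3) / 6"
  have "cmod (char centered_chisq t - exp (- t\<^sup>2)) \<le> K * \<bar>t\<bar> ^ 3 + t ^ 4" for t
  proof -
    have "cmod (char centered_chisq t - (1 - t\<^sup>2 * 2 / 2)) \<le>
        (t\<^sup>2 / 6) * D.expectation (\<lambda>x. min (6 * x\<^sup>2) (\<bar>t\<bar> * \<bar>x\<bar> ^ 3))"
      using D.char_approx3[OF i1 e1 i2 e2, of t] by simp
    also have "\<dots> \<le> (t\<^sup>2 / 6) * D.expectation (\<lambda>x. \<bar>t\<bar> * \<bar>x\<bar> ^ 3)"
      by (intro mult_left_mono integral_mono) (use i2 i3 in auto)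
    also have "\<dots> = K * \<bar>t\<bar> ^ 3"
    proof -
      have "t\<^sup>2 * \<bar>t\<bar> = \<bar>t\<bar> ^ 3"
        by (simp add: power2_eq_square power3_eq_cube)
      then show ?thesis
        by (simp add: K_def algebra_simps)
    qed
    finally have 1: "cmod (char centered_chisq t - (1 - t\<^sup>2)) \<le> K * \<bar>t\<bar> ^ 3"
      by simp
    have "cmod ((1 - t\<^sup>2) - exp (- t\<^sup>2)) = \<bar>exp (- t\<^sup>2) - (1 - t\<^sup>2)\<bar>"
      by (metis abs_minus_commute norm_of_real of_real_1 of_real_diff)
    also have "\<dots> \<le> t ^ 4"
      using exp_minus_approx[of "t\<^sup>2"] by (simp flip: power_mult)
    finally have 2: "cmod ((1 - t\<^sup>2) - exp (- t\<^sup>2)) \<le> t ^ 4" .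
    show ?thesis
      using norm_triangle_le[OF add_mono[OF 1 2]] by (simp add: algebra_simps)
  qed
  moreover have "K \<ge> 0"
    unfolding K_def by simp
  ultimately show ?thesis by blast
qed

lemma char_finite_chisq_sum:
  fixes a :: "nat \<Rightarrow> real"
  shows "char (distr xi_space borel (\<lambda>\<xi>. \<Sum>i<N. a i * ((\<xi> (Suc i))\<^sup>2 - 1))) t =
    (\<Prod>i<N. char centered_chisq (t * a i))"
proof -
  have "xi.indep_vars (\<lambda>_. borel) (\<lambda>j \<xi>. a (j - 1) * ((\<xi> j)\<^sup>2 - 1)) (Suc ` {..<N})"
    by (rule xi.indep_vars_compose2[OF xi.indep_vars_subset[OF indep_vars_xi]]) auto
  then have "char (distr xi_space borel (\<lambda>\<xi>. \<Sum>j\<in>Suc ` {..<N}. a (j - 1) * ((\<xi> j)\<^sup>2 - 1))) t =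
      (\<Prod>j\<in>Suc ` {..<N}. char (distr xi_space borel (\<lambda>\<xi>. a (j - 1) * ((\<xi> j)\<^sup>2 - 1))) t)"
    by (rule xi.char_distr_sum)
  also have "\<dots> = (\<Prod>j\<in>Suc ` {..<N}. char centered_chisq (t * a (j - 1)))"
  proof (rule prod.cong[OF refl])
    fix j
    have "char (distr xi_space borel (\<lambda>\<xi>. a (j - 1) * ((\<xi> j)\<^sup>2 - 1))) t =
        (\<integral>\<xi>. iexp (t * (a (j - 1) * ((\<xi> j)\<^sup>2 - 1))) \<partial>xi_space)"
      unfolding char_def by (subst integral_distr) auto
    also have "\<dots> = (\<integral>x. iexp (t * (a (j - 1) * (x\<^sup>2 - 1))) \<partial>std_normal_distribution)"
      by (rule integral_xi_component) measurable
    also have "\<dots> = char centered_chisq (t * a (j - 1))"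
      unfolding char_def by (subst integral_distr) (auto simp: mult.assoc)
    finally show "char (distr xi_space borel (\<lambda>\<xi>. a (j - 1) * ((\<xi> j)\<^sup>2 - 1))) t =
      char centered_chisq (t * a (j - 1))" .
  qed
  finally show ?thesis
    by (simp add: sum.reindex prod.reindex)
qed

lemma summable_power2_of_bounded:
  fixes a :: "nat \<Rightarrow> real"
  assumes "\<And>i. 0 \<le> a i" "\<And>i. a i \<le> m" "summable a"
  shows "summable (\<lambda>i. (a i)\<^sup>2)"
  by (rule summable_comparison_test'[OF summable_mult[OF assms(3), of m], of 0])
     (use assms(1,2) in \<open>auto simp: power2_eq_square intro: mult_right_mono\<close>)

text \<open>For factors of modulus at most 1, the difference of two products is at most the sum of
  the differences of the factors. The i-th difference is at most the claimed bound times
  \<open>(a i)^2\<close>, and these squares sum to 1/2. \<open>K\<close> is chosen before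
  \<open>a\<close>, \<open>m\<close> and \<open>t\<close>, so the estimate can be used along a
  sequence of weights.\<close>

lemma char_weighted_chisq_approx:
  "\<exists>K\<ge>0. \<forall>(a :: nat \<Rightarrow> real) m t. (\<forall>i. 0 \<le> a i \<and> a i \<le> m) \<longrightarrow> summable a \<longrightarrow> (\<Sum>i. (a i)\<^sup>2) = 1 / 2 \<longrightarrow>
    cmod (char (distr xi_space borel (\<lambda>\<xi>. (\<Sum>i. a i * (\<xi> (Suc i))\<^sup>2) - (\<Sum>i. a i))) t - exp (- t\<^sup>2 / 2))
      \<le> K * \<bar>t\<bar> ^ 3 * m + t ^ 4 * m\<^sup>2"
proof -
  obtain K where K: "K \<ge> 0"
    and cK: "\<And>t. cmod (char centered_chisq t - exp (- t\<^sup>2)) \<le> K * \<bar>t\<bar> ^ 3 + t ^ 4"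
    using char_centered_chisq_approx by blast
  interpret D: real_distribution centered_chisq by (rule real_distribution_centered_chisq)
  have "cmod (char (distr xi_space borel (\<lambda>\<xi>. (\<Sum>i. a i * (\<xi> (Suc i))\<^sup>2) - (\<Sum>i. a i))) t - exp (- t\<^sup>2 / 2))
      \<le> K * \<bar>t\<bar> ^ 3 * m + t ^ 4 * m\<^sup>2" (is "cmod (char (distr _ _ ?Z) t - _) \<le> ?B")
    if a: "\<And>i. 0 \<le> a i" "\<And>i. a i \<le> m" and sm: "summable a" and half: "(\<Sum>i. (a i)\<^sup>2) = 1 / 2"
    for a :: "nat \<Rightarrow> real" and m t
  proof -
    let ?S = "\<lambda>N \<xi>. \<Sum>i<N. a i * ((\<xi> (Suc i))\<^sup>2 - 1)"
    have m: "0 \<le> m" using a[of 0] by linarith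
    have sq: "summable (\<lambda>i. (a i)\<^sup>2)"
      by (rule summable_power2_of_bounded[OF a sm])
    \<comment> \<open>Passage from truncated sums to the full series: the integrands converge almost
      surely and have modulus 1, so dominated convergence applies.\<close>
    have lim: "(\<lambda>N. char (distr xi_space borel (?S N)) t) \<longlonglongrightarrow> char (distr xi_space borel ?Z) t"
    proof -
      have "(\<lambda>N. \<integral>\<xi>. iexp (t * ?S N \<xi>) \<partial>xi_space) \<longlonglongrightarrow> (\<integral>\<xi>. iexp (t * ?Z \<xi>) \<partial>xi_space)"
      proof (rule integral_dominated_convergence[where w = "\<lambda>_. 1"])
        show "AE \<xi> in xi_space. (\<lambda>N. iexp (t * ?S N \<xi>)) \<longlonglongrightarrow> iexp (t * ?Z \<xi>)"
          using AE_summable_weighted_squares[OF a(1) sm]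
        proof eventually_elim
          case (elim \<xi>)
          have "(\<lambda>N. (\<Sum>i<N. a i * (\<xi> (Suc i))\<^sup>2) - (\<Sum>i<N. a i)) \<longlonglongrightarrow> ?Z \<xi>"
            by (intro tendsto_diff summable_LIMSEQ elim sm)
          then have "(\<lambda>N. ?S N \<xi>) \<longlonglongrightarrow> ?Z \<xi>"
            by (simp add: right_diff_distrib sum_subtractf)
          then show ?case
            by (intro tendsto_intros)
        qed
      qed auto
      then show ?thesis
        unfolding char_def by (subst (1 2) integral_distr) auto
    qed
    \<comment> \<open>The Gaussian factors multiply to the standard normal characteristic function
      because the squared weights sum to 1/2.\<close>
    have lim2: "(\<lambda>N. \<Prod>i<N. complex_of_real (exp (- (t * a i)\<^sup>2))) \<longlonglongrightarrow> exp (- t\<^sup>2 / 2)"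
    proof -
      have "(\<lambda>N. complex_of_real (exp (- (t\<^sup>2 * (\<Sum>i<N. (a i)\<^sup>2))))) \<longlonglongrightarrow>
          complex_of_real (exp (- (t\<^sup>2 * (\<Sum>i. (a i)\<^sup>2))))"
        by (intro tendsto_intros summable_LIMSEQ sq)
      then show ?thesis
        by (simp add: half exp_sum[symmetric] sum_distrib_left sum_negf power_mult_distrib flip: of_real_prod)
    qed
    have bd: "cmod (char (distr xi_space borel (?S N)) t - (\<Prod>i<N. complex_of_real (exp (- (t * a i)\<^sup>2)))) \<le> ?B" for N
    proof -
      have "cmod (char (distr xi_space borel (?S N)) t - (\<Prod>i<N. complex_of_real (exp (- (t * a i)\<^sup>2)))) \<le>
          (\<Sum>i<N. cmod (char centered_chisq (t * a i) - complex_of_real (exp (- (t * a i)\<^sup>2))))"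
        unfolding char_finite_chisq_sum
        by (rule norm_prod_diff) (auto intro: D.cmod_char_le_1)
      also have "\<dots> \<le> (\<Sum>i<N. (K * \<bar>t\<bar> ^ 3 * m + t ^ 4 * m\<^sup>2) * (a i)\<^sup>2)"
      proof (rule sum_mono)
        fix i
        have "cmod (char centered_chisq (t * a i) - complex_of_real (exp (- (t * a i)\<^sup>2)))
            \<le> K * \<bar>t * a i\<bar> ^ 3 + (t * a i) ^ 4"
          using cK[of "t * a i"] by simp
        also have "\<dots> = K * \<bar>t\<bar> ^ 3 * (a i * (a i)\<^sup>2) + t ^ 4 * ((a i)\<^sup>2 * (a i)\<^sup>2)"
          using a(1)[of i] by (simp add: abs_mult power_mult_distrib power3_eq_cube power2_eq_square power4_eq_xxxx)
        also have "\<dots> \<le> K * \<bar>t\<bar> ^ 3 * (m * (a i)\<^sup>2) + t ^ 4 * (m\<^sup>2 * (a i)\<^sup>2)"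
          using a K by (intro add_mono mult_left_mono mult_right_mono power_mono) auto
        finally show "cmod (char centered_chisq (t * a i) - complex_of_real (exp (- (t * a i)\<^sup>2)))
            \<le> (K * \<bar>t\<bar> ^ 3 * m + t ^ 4 * m\<^sup>2) * (a i)\<^sup>2"
          by (simp add: algebra_simps)
      qed
      also have "\<dots> = (K * \<bar>t\<bar> ^ 3 * m + t ^ 4 * m\<^sup>2) * (\<Sum>i<N. (a i)\<^sup>2)"
        by (simp add: sum_distrib_left)
      also have "\<dots> \<le> (K * \<bar>t\<bar> ^ 3 * m + t ^ 4 * m\<^sup>2) * 1"
      proof (rule mult_left_mono)
        have "(\<Sum>i<N. (a i)\<^sup>2) \<le> (\<Sum>i. (a i)\<^sup>2)"
          by (rule sum_le_suminf[OF sq]) auto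
        then show "(\<Sum>i<N. (a i)\<^sup>2) \<le> 1" using half by simp
      qed (use K m in auto)
      finally show ?thesis by simp
    qed
    show ?thesis
      by (rule Lim_bounded[OF tendsto_norm[OF tendsto_diff[OF lim lim2]]]) (use bd in blast)
  qed
  with K show ?thesis by blast
qed

lemma isCont_cdf_std_normal: "isCont (cdf std_normal_distribution) x"
proof -
  interpret real_distribution std_normal_distribution by (rule real_dist_normal_dist)
  have "{x} \<in> null_sets std_normal_distribution"
    using AE_lborel_singleton[of x] by (subst null_sets_density_iff) (auto simp: frequently_def)
  then show ?thesis
    by (simp add: isCont_cdf measure_eq_0_null_sets)
qed

text \<open>For fixed \<open>t\<close> the bound on the distance between the characteristic
  functions vanishes with \<open>m n\<close>, so Levy's theorem gives weak convergence. Uniform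
  smallness of the weights plays the part of Lindeberg's condition, and continuity of the normal
  distribution function gives convergence at every \<open>x\<close>.\<close>

lemma weighted_chisq_clt:
  fixes a :: "nat \<Rightarrow> nat \<Rightarrow> real" and m :: "nat \<Rightarrow> real"
  assumes bounds: "\<And>n i. 1 \<le> n \<Longrightarrow> 0 \<le> a n i \<and> a n i \<le> m n"
    and sm: "\<And>n. 1 \<le> n \<Longrightarrow> summable (a n)"
    and half: "\<And>n. 1 \<le> n \<Longrightarrow> (\<Sum>i. (a n i)\<^sup>2) = 1 / 2"
    and m: "m \<longlonglongrightarrow> 0"
  shows "(\<lambda>n. measure xi_space {\<xi> \<in> space xi_space. (\<Sum>i. a n i * (\<xi> (Suc i))\<^sup>2) - (\<Sum>i. a n i) \<le> x})
    \<longlonglongrightarrow> cdf std_normal_distribution x"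
proof -
  define Z where "Z n \<xi> = (\<Sum>i. a n i * (\<xi> (Suc i))\<^sup>2) - (\<Sum>i. a n i)" for n and \<xi> :: "nat \<Rightarrow> real"
  have [measurable]: "Z n \<in> borel_measurable xi_space" for n
    unfolding Z_def by measurable
  obtain K where K: "\<And>(a :: nat \<Rightarrow> real) m t. (\<forall>i. 0 \<le> a i \<and> a i \<le> m) \<Longrightarrow> summable a \<Longrightarrow> (\<Sum>i. (a i)\<^sup>2) = 1 / 2 \<Longrightarrow>
    cmod (char (distr xi_space borel (\<lambda>\<xi>. (\<Sum>i. a i * (\<xi> (Suc i))\<^sup>2) - (\<Sum>i. a i))) t - exp (- t\<^sup>2 / 2))
      \<le> K * \<bar>t\<bar> ^ 3 * m + t ^ 4 * m\<^sup>2"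
    using char_weighted_chisq_approx by blast
  have "weak_conv_m (\<lambda>n. distr xi_space borel (Z n)) std_normal_distribution"
  proof (rule levy_continuity)
    fix t
    have "(\<lambda>n. K * \<bar>t\<bar> ^ 3 * m n + t ^ 4 * (m n)\<^sup>2) \<longlonglongrightarrow> K * \<bar>t\<bar> ^ 3 * 0 + t ^ 4 * 0\<^sup>2"
      by (intro tendsto_intros m)
    then have "(\<lambda>n. K * \<bar>t\<bar> ^ 3 * m n + t ^ 4 * (m n)\<^sup>2) \<longlonglongrightarrow> 0"
      by simp
    moreover have "eventually (\<lambda>n. cmod (char (distr xi_space borel (Z n)) t - exp (- t\<^sup>2 / 2)) \<le>
        K * \<bar>t\<bar> ^ 3 * m n + t ^ 4 * (m n)\<^sup>2) sequentially"
      using eventually_ge_at_top[of 1]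
      by eventually_elim (use K bounds sm half in \<open>simp add: Z_def[abs_def]\<close>)
    ultimately have "(\<lambda>n. char (distr xi_space borel (Z n)) t - exp (- t\<^sup>2 / 2)) \<longlonglongrightarrow> 0"
      by (rule Lim_null_comparison[rotated])
    then show "(\<lambda>n. char (distr xi_space borel (Z n)) t) \<longlonglongrightarrow> char std_normal_distribution t"
      by (simp add: char_std_normal_distribution Lim_null[symmetric])
  qed (auto intro: real_dist_normal_dist)
  then have "(\<lambda>n. cdf (distr xi_space borel (Z n)) x) \<longlonglongrightarrow> cdf std_normal_distribution x"
    by (simp add: weak_conv_m_def weak_conv_def isCont_cdf_std_normal)
  moreover have "cdf (distr xi_space borel (Z n)) x = measure xi_space {\<xi> \<in> space xi_space. Z n \<xi> \<le> x}" for n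
    unfolding cdf_def by (subst measure_distr) (auto intro!: arg_cong[where f = "measure xi_space"])
  ultimately show ?thesis
    by (simp add: Z_def)
qed

section \<open>Error probabilities in terms of the signal\<close>

text \<open>The density is positive everywhere, so a nondegenerate interval cannot be a null set.
  Strictness is what turns a fixed shift of the statistic into a genuine gain of power.\<close>

lemma cdf_std_normal_strict_mono:
  assumes "x < y"
  shows "cdf std_normal_distribution x < cdf std_normal_distribution y"
proof -
  interpret real_distribution std_normal_distribution by (rule real_dist_normal_dist)
  have "{x<..y} \<notin> null_sets std_normal_distribution"
  proof
    assume "{x<..y} \<in> null_sets std_normal_distribution"
    then have "AE z in lborel. z \<in> {x<..y} \<longrightarrow> ennreal (std_normal_density z) = 0"
      by (subst (asm) null_sets_density_iff) auto
    then have "AE z in lborel. z \<notin> {x<..y}"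
    proof eventually_elim
      case (elim z)
      then show ?case
        using normal_density_pos[of 1 0 z] by (auto simp: ennreal_eq_0_iff)
    qed
    then have "emeasure lborel {x<..y} = 0"
      by (subst (asm) AE_iff_measurable[where N = "{x<..y}"]) auto
    with assms show False by simp
  qed
  then have "0 < prob {x<..y}"
    using measure_eq_0_null_sets by (auto simp: zero_less_measure_iff null_sets_def emeasure_eq_measure)
  then show ?thesis
    using cdf_diff_eq[OF assms] by simp
qed

lemma cdf_std_normal_surj:
  assumes "0 < p" "p < 1"
  obtains z where "cdf std_normal_distribution z = p"
proof -
  interpret real_distribution std_normal_distribution by (rule real_dist_normal_dist)
  obtain lo where lo: "cdf std_normal_distribution lo < p"
    using order_tendstoD(2)[OF cdf_lim_at_bot assms(1)]
    by (auto simp: eventually_at_bot_linorder)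
  obtain hi where hi: "p < cdf std_normal_distribution hi"
    using order_tendstoD(1)[OF cdf_lim_at_top_prob assms(2)]
    by (auto simp: eventually_at_top_linorder)
  have "lo \<le> hi"
    using lo hi cdf_nondecreasing[of hi lo] by linarith
  then show thesis
    using IVT[of "cdf std_normal_distribution" lo p hi] lo hi isCont_cdf_std_normal that by auto
qed

section \<open>Splitting the statistic into noise, cross term and signal\<close>

text \<open>One sample size after rescaling: \<open>a\<close> stands for the weights divided by the
  null standard deviation, up to the noise variance, and \<open>h\<close> for the coefficients in
  units of the noise level. Inside, \<open>W\<close> is the normalised statistic, \<open>Z\<close>
  its value without signal, \<open>X\<close> the cross term and \<open>s\<close> the signal.\<close>

locale signal_plus_noise =
  fixes a h :: "nat \<Rightarrow> real" and m :: real
  assumes a_nonneg: "0 \<le> a i" and a_le: "a i \<le> m"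
    and a_summable: "summable a" and h_summable: "summable (\<lambda>i. (h i)\<^sup>2)"
begin

definition Z :: "(nat \<Rightarrow> real) \<Rightarrow> real" where
  "Z \<xi> = (\<Sum>i. a i * (\<xi> (Suc i))\<^sup>2) - (\<Sum>i. a i)"

definition W :: "(nat \<Rightarrow> real) \<Rightarrow> real" where
  "W \<xi> = (\<Sum>i. a i * (h i + \<xi> (Suc i))\<^sup>2) - (\<Sum>i. a i)"

definition X :: "(nat \<Rightarrow> real) \<Rightarrow> real" where
  "X \<xi> = (\<Sum>i. 2 * a i * h i * \<xi> (Suc i))"

definition s :: real where
  "s = (\<Sum>i. a i * (h i)\<^sup>2)"

lemma measurable_ZWX [measurable]:
  "Z \<in> borel_measurable xi_space" "W \<in> borel_measurable xi_space" "X \<in> borel_measurable xi_space"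
  unfolding Z_def W_def X_def by measurable

lemma m_nonneg: "0 \<le> m"
  using a_nonneg[of 0] a_le[of 0] by linarith

lemma signal_summable: "summable (\<lambda>i. a i * (h i)\<^sup>2)"
  by (rule summable_comparison_test'[OF summable_mult[OF h_summable, of m], of 0])
     (use a_nonneg a_le in \<open>auto intro: mult_right_mono\<close>)

lemma s_nonneg: "0 \<le> s"
  unfolding s_def by (intro suminf_nonneg signal_summable) (simp add: a_nonneg)

text \<open>By \<open>2 * \<bar>x * y\<bar> \<le> x^2 + y^2\<close> the cross terms are dominated by
  the signal series plus the noise series.\<close>

lemma cross_summable:
  assumes "summable (\<lambda>i. a i * (\<xi> (Suc i))\<^sup>2)"
  shows "summable (\<lambda>i. 2 * a i * h i * \<xi> (Suc i))"
proof (rule summable_comparison_test'[OF summable_add[OF signal_summable assms], of 0])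
  fix i
  have "2 * \<bar>x * y\<bar> \<le> x\<^sup>2 + y\<^sup>2" for x y :: real
    using zero_le_power2[of "\<bar>x\<bar> - \<bar>y\<bar>"] by (simp add: power2_diff abs_mult)
  then have "a i * (2 * \<bar>h i * \<xi> (Suc i)\<bar>) \<le> a i * ((h i)\<^sup>2 + (\<xi> (Suc i))\<^sup>2)"
    by (intro mult_left_mono a_nonneg)
  then show "norm (2 * a i * h i * \<xi> (Suc i)) \<le> a i * (h i)\<^sup>2 + a i * (\<xi> (Suc i))\<^sup>2"
    using a_nonneg[of i] by (simp add: abs_mult algebra_simps)
qed

text \<open>The square may be expanded inside the series wherever the noise series converges.
  Summability is recorded too, since rescaling the statistic later requires it.\<close>

lemma AE_decomposition:
  "AE \<xi> in xi_space. summable (\<lambda>i. a i * (h i + \<xi> (Suc i))\<^sup>2) \<and> W \<xi> = Z \<xi> + X \<xi> + s"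
  using AE_summable_weighted_squares[OF a_nonneg a_summable]
proof eventually_elim
  case (elim \<xi>)
  have eq: "a i * (h i + \<xi> (Suc i))\<^sup>2 =
      a i * (\<xi> (Suc i))\<^sup>2 + 2 * a i * h i * \<xi> (Suc i) + a i * (h i)\<^sup>2" for i
    by (simp add: power2_sum algebra_simps)
  have "(\<lambda>i. a i * (h i + \<xi> (Suc i))\<^sup>2) sums
      ((\<Sum>i. a i * (\<xi> (Suc i))\<^sup>2) + X \<xi> + s)"
    unfolding eq X_def s_def
    by (intro sums_add summable_sums elim cross_summable signal_summable)
  then show ?case
    by (auto simp: W_def Z_def sums_iff)
qed

text \<open>One factor \<open>a i\<close> of each squared coefficient is bounded by
  \<open>m\<close>, so the second moment of \<open>X\<close> is at most \<open>4 * m * s\<close>;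
  the rest is Chebyshev's inequality.\<close>

lemma cross_tail:
  assumes "0 < \<delta>"
  shows "measure xi_space {\<xi> \<in> space xi_space. \<delta> \<le> \<bar>X \<xi>\<bar>} \<le> 4 * m * s / \<delta>\<^sup>2"
proof -
  have le: "(2 * a i * h i)\<^sup>2 \<le> 4 * m * (a i * (h i)\<^sup>2)" for i
  proof -
    have "(2 * a i * h i)\<^sup>2 = 4 * (a i * (a i * (h i)\<^sup>2))"
      by (simp add: power2_eq_square algebra_simps)
    also have "\<dots> \<le> 4 * (m * (a i * (h i)\<^sup>2))"
      by (intro mult_left_mono mult_right_mono a_le) (simp_all add: a_nonneg)
    finally show ?thesis by simp
  qed
  have sq: "summable (\<lambda>i. (2 * a i * h i)\<^sup>2)"
    by (rule summable_comparison_test'[OF summable_mult[OF signal_summable, of "4 * m"], of 0])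
       (use le in auto)
  have "measure xi_space {\<xi> \<in> space xi_space. \<delta> \<le> \<bar>X \<xi>\<bar>} \<le> (\<Sum>i. (2 * a i * h i)\<^sup>2) / \<delta>\<^sup>2"
    unfolding X_def
  proof (rule linear_form_tail_bound[OF _ sq assms])
    show "AE \<xi> in xi_space. summable (\<lambda>i. 2 * a i * h i * \<xi> (Suc i))"
      using AE_summable_weighted_squares[OF a_nonneg a_summable]
      by eventually_elim (rule cross_summable)
  qed
  also have "(\<Sum>i. (2 * a i * h i)\<^sup>2) \<le> (\<Sum>i. 4 * m * (a i * (h i)\<^sup>2))"
    by (intro suminf_le le sq summable_mult signal_summable)
  also have "\<dots> = 4 * m * s"
    unfolding s_def by (rule suminf_mult[OF signal_summable])
  finally show ?thesis
    by (simp add: divide_right_mono)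
qed

text \<open>If the cross term is below \<open>s / 2\<close> in modulus, at least half of the signal
  survives and shifts the threshold for \<open>Z\<close>. The exceptional event costs
  \<open>4 * m * s / (s / 2)^2 = 16 * m / s\<close>, which decreases in \<open>s\<close>, so
  arbitrarily large signals cause no trouble.\<close>

lemma prob_W_upper:
  assumes "0 < s"
  shows "measure xi_space {\<xi> \<in> space xi_space. W \<xi> \<le> u} \<le>
    measure xi_space {\<xi> \<in> space xi_space. Z \<xi> \<le> u - s / 2} + 16 * m / s"
proof -
  let ?A = "{\<xi> \<in> space xi_space. Z \<xi> \<le> u - s / 2}"
  let ?B = "{\<xi> \<in> space xi_space. s / 2 \<le> \<bar>X \<xi>\<bar>}"
  have "measure xi_space {\<xi> \<in> space xi_space. W \<xi> \<le> u} \<le> measure xi_space (?A \<union> ?B)"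
  proof (rule xi.finite_measure_mono_AE)
    show "AE \<xi> in xi_space. \<xi> \<in> {\<xi> \<in> space xi_space. W \<xi> \<le> u} \<longrightarrow> \<xi> \<in> ?A \<union> ?B"
      using AE_decomposition by eventually_elim auto
  qed measurable
  also have "\<dots> \<le> measure xi_space ?A + measure xi_space ?B"
    by (rule measure_Un_le) measurable
  also have "measure xi_space ?B \<le> 16 * m / s"
    using cross_tail[of "s / 2"] assms by (simp add: power2_eq_square field_simps)
  finally show ?thesis by simp
qed

text \<open>Conversely, a cross term below \<open>\<delta>\<close> in modulus raises
  \<open>W\<close> above \<open>Z\<close> by less than \<open>s + \<delta>\<close>. This is applied
  when \<open>s\<close> is small.\<close>

lemma prob_W_lower:
  assumes "0 < \<delta>"
  shows "measure xi_space {\<xi> \<in> space xi_space. Z \<xi> \<le> u - s - \<delta>} - 4 * m * s / \<delta>\<^sup>2 \<le>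
    measure xi_space {\<xi> \<in> space xi_space. W \<xi> \<le> u}"
proof -
  let ?A = "{\<xi> \<in> space xi_space. W \<xi> \<le> u}"
  let ?B = "{\<xi> \<in> space xi_space. \<delta> \<le> \<bar>X \<xi>\<bar>}"
  have "measure xi_space {\<xi> \<in> space xi_space. Z \<xi> \<le> u - s - \<delta>} \<le> measure xi_space (?A \<union> ?B)"
  proof (rule xi.finite_measure_mono_AE)
    show "AE \<xi> in xi_space. \<xi> \<in> {\<xi> \<in> space xi_space. Z \<xi> \<le> u - s - \<delta>} \<longrightarrow> \<xi> \<in> ?A \<union> ?B"
      using AE_decomposition by eventually_elim auto
  qed measurable
  also have "\<dots> \<le> measure xi_space ?A + measure xi_space ?B"
    by (rule measure_Un_le) measurable
  finally show ?thesis
    using cross_tail[OF assms] by simp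
qed

end

section \<open>From error probabilities to the normalised statistic\<close>

text \<open>The statistic equals \<open>\<sigma>^2 / n * V\<close> times \<open>W\<close>, so the
  threshold is divided by this factor. The identity is proved almost surely, on the event where the
  series converges and constants can be taken out.\<close>

lemma beta_err_normalised:
  fixes \<kappa>2 :: "nat \<Rightarrow> nat \<Rightarrow> real" and \<theta> :: "nat \<Rightarrow> real"
  assumes n: "1 \<le> n" and \<sigma>: "0 < \<sigma>" and V: "0 < V"
    and spn: "signal_plus_noise (\<lambda>i. \<kappa>2 n (Suc i) / V) (\<lambda>i. \<theta> (Suc i) / (\<sigma> / sqrt n)) m"
  shows "beta_err \<kappa>2 \<sigma> n t \<theta> = measure xi_space {\<xi> \<in> space xi_space.
    signal_plus_noise.W (\<lambda>i. \<kappa>2 n (Suc i) / V) (\<lambda>i. \<theta> (Suc i) / (\<sigma> / sqrt n)) \<xi> \<le> t / (\<sigma>\<^sup>2 / n * V)}"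
proof -
  interpret signal_plus_noise "\<lambda>i. \<kappa>2 n (Suc i) / V" "\<lambda>i. \<theta> (Suc i) / (\<sigma> / sqrt n)" m
    by (rule spn)
  let ?d = "\<sigma>\<^sup>2 / n * V"
  have d: "0 < ?d" using n \<sigma> V by simp
  have [measurable]: "(\<lambda>\<xi>. Tstat \<kappa>2 \<sigma> n (obs \<sigma> n \<theta> \<xi>)) \<in> borel_measurable xi_space"
    unfolding Tstat_def obs_def by measurable
  have "AE \<xi> in xi_space. Tstat \<kappa>2 \<sigma> n (obs \<sigma> n \<theta> \<xi>) = ?d * W \<xi>"
    using AE_decomposition
  proof eventually_elim
    case (elim \<xi>)
    have eq: "\<kappa>2 n (Suc i) * (obs \<sigma> n \<theta> \<xi> (Suc i))\<^sup>2 =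
        ?d * (\<kappa>2 n (Suc i) / V * (\<theta> (Suc i) / (\<sigma> / sqrt n) + \<xi> (Suc i))\<^sup>2)" for i
    proof -
      have "obs \<sigma> n \<theta> \<xi> (Suc i) = \<sigma> / sqrt n * (\<theta> (Suc i) / (\<sigma> / sqrt n) + \<xi> (Suc i))"
        using n \<sigma> by (simp add: obs_def field_simps)
      then show ?thesis
        using V by (simp add: power_mult_distrib power_divide)
    qed
    have "(\<Sum>i. \<kappa>2 n (Suc i) * (obs \<sigma> n \<theta> \<xi> (Suc i))\<^sup>2) =
        ?d * (\<Sum>i. \<kappa>2 n (Suc i) / V * (\<theta> (Suc i) / (\<sigma> / sqrt n) + \<xi> (Suc i))\<^sup>2)"
      unfolding eq using elim by (intro suminf_mult) simp
    moreover have "\<sigma>\<^sup>2 / n * rho \<kappa>2 n = ?d * (\<Sum>i. \<kappa>2 n (Suc i) / V)"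
    proof -
      have "rho \<kappa>2 n = (\<Sum>i. V * (\<kappa>2 n (Suc i) / V))"
        using V by (simp add: rho_def)
      also have "\<dots> = V * (\<Sum>i. \<kappa>2 n (Suc i) / V)"
        by (rule suminf_mult[OF a_summable])
      finally show ?thesis by simp
    qed
    ultimately show ?case
      by (simp only: Tstat_def W_def right_diff_distrib)
  qed
  then have "AE \<xi> in xi_space. Tstat \<kappa>2 \<sigma> n (obs \<sigma> n \<theta> \<xi>) \<le> t \<longleftrightarrow> W \<xi> \<le> t / ?d"
  proof eventually_elim
    case (elim \<xi>)
    show ?case
      unfolding elim using d by (simp only: pos_le_divide_eq mult.commute)
  qed
  then have "AE \<xi> in xi_space. \<xi> \<in> {\<xi> \<in> space xi_space. Tstat \<kappa>2 \<sigma> n (obs \<sigma> n \<theta> \<xi>) \<le> t} \<longleftrightarrow>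
      \<xi> \<in> {\<xi> \<in> space xi_space. W \<xi> \<le> t / ?d}"
    by eventually_elim blast
  then show ?thesis
    unfolding beta_err_def by (rule xi.finite_measure_eq_AE) measurable
qed

lemma alpha_err_eq_beta_err: "alpha_err \<kappa>2 \<sigma> n t = 1 - beta_err \<kappa>2 \<sigma> n t (\<lambda>_. 0)"
proof -
  have [measurable]: "(\<lambda>\<xi>. Tstat \<kappa>2 \<sigma> n (obs \<sigma> n (\<lambda>_. 0) \<xi>)) \<in> borel_measurable xi_space"
    unfolding Tstat_def obs_def by measurable
  have "{\<xi> \<in> space xi_space. Tstat \<kappa>2 \<sigma> n (obs \<sigma> n (\<lambda>_. 0) \<xi>) > t} =
      space xi_space - {\<xi> \<in> space xi_space. Tstat \<kappa>2 \<sigma> n (obs \<sigma> n (\<lambda>_. 0) \<xi>) \<le> t}"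
    by auto
  then show ?thesis
    unfolding alpha_err_def beta_err_def by (simp add: xi.prob_compl)
qed

text \<open>If the signal is at least \<open>s0\<close>, half of it moves the critical point from
  below \<open>z + s0 / 4\<close> to below \<open>z - s0 / 4\<close>, and the cross term disappears
  in the limit. Conversely, a signal below a small \<open>\<delta>\<close> leaves the type II error
  close to its value under the hypothesis; the tests with threshold 0 suffice to detect
  this.\<close>

lemma consistent_iff_signal_bounded_below:
  fixes \<kappa>2 \<theta>s :: "nat \<Rightarrow> nat \<Rightarrow> real" and \<sigma> :: real
  defines "V \<equiv> \<lambda>n. sqrt (2 * (\<Sum>i. (\<kappa>2 n (Suc i))\<^sup>2))"
  assumes \<sigma>: "0 < \<sigma>"
    and nonneg: "\<And>n j. n \<ge> 1 \<Longrightarrow> j \<ge> 1 \<Longrightarrow> \<kappa>2 n j \<ge> 0"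
    and sm: "\<And>n. n \<ge> 1 \<Longrightarrow> summable (\<lambda>i. \<kappa>2 n (Suc i))"
    and le_first: "\<And>n j. n \<ge> 1 \<Longrightarrow> j \<ge> 1 \<Longrightarrow> \<kappa>2 n j \<le> \<kappa>2 n 1"
    and pos: "\<And>n. n \<ge> 1 \<Longrightarrow> 0 < (\<Sum>i. (\<kappa>2 n (Suc i))\<^sup>2)"
    and negl: "(\<lambda>n. \<kappa>2 n 1 / V n) \<longlonglongrightarrow> 0"
    and L2: "\<And>n. n \<ge> 1 \<Longrightarrow> summable (\<lambda>i. (\<theta>s n (Suc i))\<^sup>2)"
  shows "consistent \<kappa>2 \<sigma> \<theta>s \<longleftrightarrow>
    (\<exists>s>0. eventually (\<lambda>n. s \<le> (\<Sum>i. \<kappa>2 n (Suc i) * (\<theta>s n (Suc i))\<^sup>2) / (\<sigma>\<^sup>2 / n * V n)) sequentially)"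
    (is "_ \<longleftrightarrow> (\<exists>s>0. eventually (\<lambda>n. s \<le> ?s n) sequentially)")
proof -
  define a where "a n i = \<kappa>2 n (Suc i) / V n" for n i
  define h where "h n i = \<theta>s n (Suc i) / (\<sigma> / sqrt (real n))" for n i
  define m where "m n = \<kappa>2 n 1 / V n" for n
  define d where "d n = \<sigma>\<^sup>2 / real n * V n" for n :: nat
  define F where "F n x = measure xi_space
    {\<xi> \<in> space xi_space. (\<Sum>i. a n i * (\<xi> (Suc i))\<^sup>2) - (\<Sum>i. a n i) \<le> x}" for n x
  let ?\<Phi> = "cdf std_normal_distribution"
  interpret N: real_distribution std_normal_distribution by (rule real_dist_normal_dist)
  have a_fold: "(\<lambda>i. \<kappa>2 n (Suc i) / V n) = a n"
    and h_fold: "(\<lambda>i. \<theta>s n (Suc i) / (\<sigma> / sqrt (real n))) = h n"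
    and d_fold: "\<sigma>\<^sup>2 / real n * V n = d n" for n
    by (simp_all add: a_def h_def d_def fun_eq_iff)
  have V_pos: "0 < V n" if "1 \<le> n" for n
    using pos[OF that] by (simp add: V_def)
  have d_pos: "0 < d n" if "1 \<le> n" for n
    using V_pos[OF that] that \<sigma> by (simp add: d_def)
  have m_lim: "m \<longlonglongrightarrow> 0"
    using negl by (simp add: m_def[abs_def])
  have a_bounds: "0 \<le> a n i \<and> a n i \<le> m n" if "1 \<le> n" for n i
    using nonneg[OF that, of "Suc i"] le_first[OF that, of "Suc i"] V_pos[OF that]
    by (simp add: a_def m_def divide_right_mono)
  have a_summable: "summable (a n)" if "1 \<le> n" for n
    unfolding a_def[abs_def] by (intro summable_divide sm that)
  have a_half: "(\<Sum>i. (a n i)\<^sup>2) = 1 / 2" if "1 \<le> n" for n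
  proof -
    have "summable (\<lambda>i. (\<kappa>2 n (Suc i))\<^sup>2)"
      by (rule summable_power2_of_bounded[where m = "\<kappa>2 n 1"]) (use nonneg le_first sm that in auto)
    then have "(\<Sum>i. (a n i)\<^sup>2) = (\<Sum>i. (\<kappa>2 n (Suc i))\<^sup>2) / (V n)\<^sup>2"
      unfolding a_def power_divide by (rule suminf_divide)
    also have "\<dots> = 1 / 2"
      using pos[OF that] by (simp add: V_def)
    finally show ?thesis .
  qed
  have F_lim: "(\<lambda>n. F n x) \<longlonglongrightarrow> ?\<Phi> x" for x
    unfolding F_def by (rule weighted_chisq_clt[OF a_bounds a_summable a_half m_lim])
  have F_mono: "F n x \<le> F n y" if "x \<le> y" for n x y
    unfolding F_def using that by (intro xi.finite_measure_mono) auto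
  have spn: "signal_plus_noise (a n) (h n) (m n)" if "1 \<le> n" for n
  proof
    show "summable (\<lambda>i. (h n i)\<^sup>2)"
      unfolding h_def power_divide by (intro summable_divide L2 that)
  qed (use a_bounds a_summable that in auto)
  have spn0: "signal_plus_noise (a n) (\<lambda>_. 0) (m n)" if "1 \<le> n" for n
    by standard (use a_bounds a_summable that in auto)
  have alpha: "alpha_err \<kappa>2 \<sigma> n t = 1 - F n (t / d n)" if "1 \<le> n" for n t
  proof -
    have "beta_err \<kappa>2 \<sigma> n t (\<lambda>_. 0) = F n (t / d n)"
      using beta_err_normalised[OF that \<sigma> V_pos[OF that], of \<kappa>2 "\<lambda>_. 0" "m n" t,
          unfolded a_fold d_fold div_0, OF spn0[OF that]]
      by (simp add: F_def signal_plus_noise.W_def[OF spn0[OF that]])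
    then show ?thesis
      by (simp add: alpha_err_eq_beta_err)
  qed
  have beta: "beta_err \<kappa>2 \<sigma> n t (\<theta>s n) =
      measure xi_space {\<xi> \<in> space xi_space. signal_plus_noise.W (a n) (h n) \<xi> \<le> t / d n}"
    if "1 \<le> n" for n t
    using beta_err_normalised[OF that \<sigma> V_pos[OF that], of \<kappa>2 "\<theta>s n" "m n" t] spn[OF that]
    by (simp only: a_fold h_fold d_fold)
  have FZ: "F n x = measure xi_space {\<xi> \<in> space xi_space. signal_plus_noise.Z (a n) \<xi> \<le> x}"
    if "1 \<le> n" for n x
    by (simp add: F_def signal_plus_noise.Z_def[OF spn[OF that]])
  have sig: "signal_plus_noise.s (a n) (h n) = ?s n" if "1 \<le> n" for n
  proof -
    interpret signal_plus_noise "a n" "h n" "m n" by (rule spn[OF that])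
    have eq: "\<kappa>2 n (Suc i) * (\<theta>s n (Suc i))\<^sup>2 = d n * (a n i * (h n i)\<^sup>2)" for i
      using that \<sigma> V_pos[OF that] by (simp add: a_def h_def d_def power_divide field_simps)
    have "(\<Sum>i. \<kappa>2 n (Suc i) * (\<theta>s n (Suc i))\<^sup>2) = d n * s"
      unfolding eq s_def by (rule suminf_mult[OF signal_summable])
    then show ?thesis
      unfolding d_fold using d_pos[OF that] by simp
  qed
  show ?thesis
  proof
    assume cons: "consistent \<kappa>2 \<sigma> \<theta>s"
    have \<Phi>0: "0 < ?\<Phi> 0" "?\<Phi> 0 < 1"
      using cdf_std_normal_strict_mono[of "-1" 0] cdf_std_normal_strict_mono[of 0 1]
        N.cdf_nonneg[of "-1"] N.cdf_bounded_prob[of 1] by linarith+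
    \<comment> \<open>Threshold 0 is admissible for the level \<open>1 - ?\<Phi> 0\<close>, which
      lies strictly between 0 and 1.\<close>
    have "(\<lambda>n. alpha_err \<kappa>2 \<sigma> n 0 / (1 - ?\<Phi> 0)) \<longlonglongrightarrow> 1"
    proof (rule Lim_transform_eventually)
      have "(\<lambda>n. (1 - F n 0) / (1 - ?\<Phi> 0)) \<longlonglongrightarrow> (1 - ?\<Phi> 0) / (1 - ?\<Phi> 0)"
        using \<Phi>0 by (intro tendsto_intros F_lim) auto
      then show "(\<lambda>n. (1 - F n 0) / (1 - ?\<Phi> 0)) \<longlonglongrightarrow> 1"
        using \<Phi>0 by simp
      show "eventually (\<lambda>n. (1 - F n 0) / (1 - ?\<Phi> 0) = alpha_err \<kappa>2 \<sigma> n 0 / (1 - ?\<Phi> 0)) sequentially"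
        using eventually_ge_at_top[of 1] by eventually_elim (simp add: alpha)
    qed
    then have "limsup (\<lambda>n. ereal (beta_err \<kappa>2 \<sigma> n 0 (\<theta>s n))) < ereal (1 - (1 - ?\<Phi> 0))"
      using cons[unfolded consistent_def, rule_format, of "1 - ?\<Phi> 0" "\<lambda>_. 0"] \<Phi>0 by simp
    then obtain L where L: "limsup (\<lambda>n. ereal (beta_err \<kappa>2 \<sigma> n 0 (\<theta>s n))) < ereal L" "L < ?\<Phi> 0"
      using ereal_dense2 by fastforce
    have beta_lt: "eventually (\<lambda>n. beta_err \<kappa>2 \<sigma> n 0 (\<theta>s n) < L) sequentially"
      using Limsup_lessD[OF L(1)] by simp
    \<comment> \<open>Continuity at 0 provides \<open>\<delta>\<close> with
      \<open>L < ?\<Phi> (- 2 * \<delta>)\<close>. A signal \<open>s < \<delta>\<close> together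
      with a cross term below \<open>\<delta>\<close> shifts the argument by less than
      \<open>2 * \<delta>\<close>, which would push the type II error above
      \<open>L\<close>.\<close>
    have "((\<lambda>x. ?\<Phi> (- 2 * x)) \<longlongrightarrow> ?\<Phi> (- 2 * 0)) (at_right 0)"
      by (rule isCont_tendsto_compose[OF isCont_cdf_std_normal]) (intro tendsto_intros)
    then have "eventually (\<lambda>x. L < ?\<Phi> (- 2 * x)) (at_right 0)"
      using L(2) by (intro order_tendstoD(1)) auto
    then obtain b where b: "b > 0" "\<And>y. 0 < y \<Longrightarrow> y < b \<Longrightarrow> L < ?\<Phi> (- 2 * y)"
      unfolding eventually_at_right_field by auto
    define \<delta> where "\<delta> = b / 2"
    have \<delta>: "0 < \<delta>" "L < ?\<Phi> (- 2 * \<delta>)"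
      using b(1) b(2)[of \<delta>] by (simp_all add: \<delta>_def)
    have "(\<lambda>n. F n (- 2 * \<delta>) - 4 * m n / \<delta>) \<longlonglongrightarrow> ?\<Phi> (- 2 * \<delta>) - 4 * 0 / \<delta>"
      using \<delta> by (intro tendsto_intros F_lim m_lim) auto
    then have "eventually (\<lambda>n. L < F n (- 2 * \<delta>) - 4 * m n / \<delta>) sequentially"
      using \<delta> by (intro order_tendstoD(1)) auto
    then have "eventually (\<lambda>n. \<delta> \<le> ?s n) sequentially"
      using beta_lt eventually_ge_at_top[of 1]
    proof eventually_elim
      case (elim n)
      interpret signal_plus_noise "a n" "h n" "m n" using elim by (intro spn) simp
      have "\<delta> \<le> s"
      proof (rule ccontr)
        assume "\<not> \<delta> \<le> s"
        then have "s < \<delta>" by simp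
        then have "4 * m n * s / \<delta>\<^sup>2 \<le> 4 * m n * \<delta> / \<delta>\<^sup>2"
          using m_nonneg by (intro divide_right_mono mult_left_mono) auto
        also have "\<dots> = 4 * m n / \<delta>"
          using \<delta> by (simp add: power2_eq_square)
        finally have "4 * m n * s / \<delta>\<^sup>2 \<le> 4 * m n / \<delta>" .
        moreover have "F n (- 2 * \<delta>) \<le> F n (0 - s - \<delta>)"
          using \<open>s < \<delta>\<close> by (intro F_mono) simp
        moreover have "F n (0 - s - \<delta>) - 4 * m n * s / \<delta>\<^sup>2 \<le> beta_err \<kappa>2 \<sigma> n 0 (\<theta>s n)"
          using prob_W_lower[OF \<delta>(1), of 0] elim by (simp add: FZ beta)
        ultimately show False
          using elim by linarith
      qed
      then show ?case
        using sig elim by simp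
    qed
    with \<delta>(1) show "\<exists>s>0. eventually (\<lambda>n. s \<le> ?s n) sequentially" by blast
  next
    assume "\<exists>s>0. eventually (\<lambda>n. s \<le> ?s n) sequentially"
    then obtain s0 where s0: "0 < s0" "eventually (\<lambda>n. s0 \<le> ?s n) sequentially" by blast
    show "consistent \<kappa>2 \<sigma> \<theta>s"
      unfolding consistent_def
    proof (intro allI impI)
      fix \<alpha> :: real and t :: "nat \<Rightarrow> real"
      assume \<alpha>: "0 < \<alpha> \<and> \<alpha> < 1"
        and lim: "(\<lambda>n. alpha_err \<kappa>2 \<sigma> n (t n) / \<alpha>) \<longlonglongrightarrow> 1"
      define u where "u n = t n / d n" for n
      obtain z where z: "?\<Phi> z = 1 - \<alpha>"
        using \<alpha> cdf_std_normal_surj[of "1 - \<alpha>"] by auto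
      \<comment> \<open>The values of \<open>F n\<close> at the normalised thresholds tend to
        \<open>1 - \<alpha> = ?\<Phi> z\<close>, strictly below \<open>?\<Phi> (z + s0 / 4)\<close>.
        Monotonicity of \<open>F n\<close> then gives \<open>u n < z + s0 / 4\<close> eventually,
        with no appeal to convergence of \<open>u n\<close>.\<close>
      have "(\<lambda>n. 1 - alpha_err \<kappa>2 \<sigma> n (t n) / \<alpha> * \<alpha>) \<longlonglongrightarrow> 1 - 1 * \<alpha>"
        by (intro tendsto_intros lim)
      then have "(\<lambda>n. F n (z + s0 / 4) - (1 - alpha_err \<kappa>2 \<sigma> n (t n))) \<longlonglongrightarrow> ?\<Phi> (z + s0 / 4) - (1 - \<alpha>)"
        using \<alpha> by (intro tendsto_diff[OF F_lim]) simp
      then have "eventually (\<lambda>n. 0 < F n (z + s0 / 4) - (1 - alpha_err \<kappa>2 \<sigma> n (t n))) sequentially"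
        by (rule order_tendstoD(1)) (use cdf_std_normal_strict_mono[of z "z + s0 / 4"] s0(1) z in simp)
      then have "eventually (\<lambda>n. beta_err \<kappa>2 \<sigma> n (t n) (\<theta>s n) \<le> F n (z - s0 / 4) + 16 * m n / s0) sequentially"
        using s0(2) eventually_ge_at_top[of 1]
      proof eventually_elim
        case (elim n)
        interpret signal_plus_noise "a n" "h n" "m n" using elim by (intro spn) simp
        have s: "s0 \<le> s" using sig elim by simp
        have "F n (u n) < F n (z + s0 / 4)"
          using elim alpha[of n "t n"] by (simp add: u_def)
        then have "u n < z + s0 / 4"
          using F_mono[of "z + s0 / 4" "u n" n] by linarith
        then have "F n (u n - s / 2) \<le> F n (z - s0 / 4)"
          using s by (intro F_mono) linarith
        moreover have "16 * m n / s \<le> 16 * m n / s0"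
          using s s0(1) m_nonneg by (intro divide_left_mono) auto
        moreover have "beta_err \<kappa>2 \<sigma> n (t n) (\<theta>s n) \<le> F n (u n - s / 2) + 16 * m n / s"
          using prob_W_upper[of "u n"] s s0(1) elim by (simp add: FZ beta u_def)
        ultimately show ?case by linarith
      qed
      then have "limsup (\<lambda>n. ereal (beta_err \<kappa>2 \<sigma> n (t n) (\<theta>s n))) \<le>
          limsup (\<lambda>n. ereal (F n (z - s0 / 4) + 16 * m n / s0))"
        by (intro Limsup_mono) simp
      also have "\<dots> = ereal (?\<Phi> (z - s0 / 4) + 16 * 0 / s0)"
        using s0(1) by (intro lim_imp_Limsup tendsto_ereal tendsto_intros F_lim m_lim) auto
      also have "\<dots> < ereal (1 - \<alpha>)"
        using cdf_std_normal_strict_mono[of "z - s0 / 4" z] s0(1) z by simp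
      finally show "limsup (\<lambda>n. ereal (beta_err \<kappa>2 \<sigma> n (t n) (\<theta>s n))) < ereal (1 - \<alpha>)" .
    qed
  qed
qed

section \<open>Weights and signal\<close>

text \<open>Partial sums eventually exceed half of the positive total, so the set defining
  \<open>kn\<close> is finite and its supremum is a maximum. It contains 1 because the corresponding
  sum is empty. Since \<open>Suc (kn \<kappa>2 n)\<close> is not in the set, the weights up to and
  including \<open>kn\<close> carry more than half of the total.\<close>

lemma kn_properties:
  assumes nonneg: "\<And>j. j \<ge> 1 \<Longrightarrow> \<kappa>2 n j \<ge> 0"
    and sm: "summable (\<lambda>i. \<kappa>2 n (Suc i))" and pos: "0 < rho \<kappa>2 n"
  shows "1 \<le> kn \<kappa>2 n" "rho \<kappa>2 n / 2 < (\<Sum>j\<in>{1..kn \<kappa>2 n}. \<kappa>2 n j)"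
proof -
  let ?X = "{k. (\<Sum>j\<in>{1..<k}. \<kappa>2 n j) \<le> rho \<kappa>2 n / 2}"
  have shift: "(\<Sum>i<K. \<kappa>2 n (Suc i)) = (\<Sum>j\<in>{1..<Suc K}. \<kappa>2 n j)" for K
    by (rule sum.reindex_bij_witness[where i = "\<lambda>j. j - 1" and j = Suc]) auto
  have "(\<lambda>K. \<Sum>i<K. \<kappa>2 n (Suc i)) \<longlonglongrightarrow> rho \<kappa>2 n"
    unfolding rho_def by (rule summable_LIMSEQ[OF sm])
  then have "eventually (\<lambda>K. rho \<kappa>2 n / 2 < (\<Sum>i<K. \<kappa>2 n (Suc i))) sequentially"
    using pos by (intro order_tendstoD(1)) auto
  then obtain K where K: "rho \<kappa>2 n / 2 < (\<Sum>j\<in>{1..<Suc K}. \<kappa>2 n j)"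
    by (auto simp: shift eventually_sequentially)
  have "?X \<subseteq> {..K}"
  proof
    fix k assume "k \<in> ?X"
    show "k \<in> {..K}"
    proof (rule ccontr)
      assume "k \<notin> {..K}"
      then have "(\<Sum>j\<in>{1..<Suc K}. \<kappa>2 n j) \<le> (\<Sum>j\<in>{1..<k}. \<kappa>2 n j)"
        by (intro sum_mono2) (auto intro: nonneg)
      with K \<open>k \<in> ?X\<close> show False by simp
    qed
  qed
  then have fin: "finite ?X"
    by (rule finite_subset) simp
  have one: "1 \<in> ?X" using pos by simp
  have kn: "kn \<kappa>2 n = Max ?X"
  proof -
    have "?X \<noteq> {}" using one by blast
    then show ?thesis
      unfolding kn_def Sup_nat_def by (rule if_not_P)
  qed
  show "1 \<le> kn \<kappa>2 n"
    unfolding kn by (rule Max_ge[OF fin one])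
  have "Suc (kn \<kappa>2 n) \<notin> ?X"
    using Max_ge[OF fin, of "Suc (Max ?X)"] unfolding kn by auto
  then show "rho \<kappa>2 n / 2 < (\<Sum>j\<in>{1..kn \<kappa>2 n}. \<kappa>2 n j)"
    by (simp add: atLeastLessThanSuc_atLeastAtMost not_le)
qed

text \<open>The first \<open>kn\<close> weights are all at least \<open>kappa_n\<close> and together
  exceed half of \<open>rho\<close>. This yields the upper bound on the order of
  \<open>kappa_n\<close>.\<close>

lemma kappa_n_le_sum_squares:
  assumes nonneg: "\<And>j. j \<ge> 1 \<Longrightarrow> \<kappa>2 n j \<ge> 0"
    and anti: "\<And>i j. 1 \<le> i \<Longrightarrow> i \<le> j \<Longrightarrow> \<kappa>2 n j \<le> \<kappa>2 n i"
    and sm: "summable (\<lambda>i. \<kappa>2 n (Suc i))" and pos: "0 < rho \<kappa>2 n"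
  shows "kappa_n \<kappa>2 n * (rho \<kappa>2 n / 2) \<le> (\<Sum>i. (\<kappa>2 n (Suc i))\<^sup>2)"
proof -
  let ?k = "kn \<kappa>2 n"
  have sq: "summable (\<lambda>i. (\<kappa>2 n (Suc i))\<^sup>2)"
    by (rule summable_power2_of_bounded[where m = "\<kappa>2 n 1"]) (use nonneg anti sm in auto)
  note kp = kn_properties[of \<kappa>2 n, OF nonneg sm pos]
  have k0: "0 \<le> kappa_n \<kappa>2 n"
    unfolding kappa_n_def using kp(1) by (rule nonneg)
  have "kappa_n \<kappa>2 n * (rho \<kappa>2 n / 2) \<le> kappa_n \<kappa>2 n * (\<Sum>j\<in>{1..?k}. \<kappa>2 n j)"
    using kp(2) k0 by (intro mult_left_mono) auto
  also have "\<dots> = (\<Sum>j\<in>{1..?k}. kappa_n \<kappa>2 n * \<kappa>2 n j)"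
    by (rule sum_distrib_left)
  also have "\<dots> \<le> (\<Sum>j\<in>{1..?k}. (\<kappa>2 n j)\<^sup>2)"
    unfolding power2_eq_square
    by (intro sum_mono mult_right_mono) (auto simp: kappa_n_def intro: anti nonneg)
  also have "\<dots> = (\<Sum>i<?k. (\<kappa>2 n (Suc i))\<^sup>2)"
    by (rule sum.reindex_bij_witness[where i = Suc and j = "\<lambda>j. j - 1"]) auto
  also have "\<dots> \<le> (\<Sum>i. (\<kappa>2 n (Suc i))\<^sup>2)"
    by (rule sum_le_suminf[OF sq]) auto
  finally show ?thesis .
qed

lemma sum_squares_le_bound_mult_sum:
  fixes w :: "nat \<Rightarrow> real"
  assumes "\<And>i. 0 \<le> w i" "\<And>i. w i \<le> m" "summable w"
  shows "(\<Sum>i. (w i)\<^sup>2) \<le> m * (\<Sum>i. w i)"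
proof -
  have "(\<Sum>i. (w i)\<^sup>2) \<le> (\<Sum>i. m * w i)"
    by (intro suminf_le summable_power2_of_bounded[OF assms] summable_mult assms(3))
       (use assms in \<open>auto simp: power2_eq_square intro: mult_right_mono\<close>)
  then show ?thesis
    by (simp add: suminf_mult[OF assms(3)])
qed

lemma weighted_sum_lower:
  fixes w g :: "nat \<Rightarrow> real"
  assumes S: "finite S" "\<And>j. j \<in> S \<Longrightarrow> 1 \<le> j" and L: "\<And>j. j \<in> S \<Longrightarrow> L \<le> w j"
    and nonneg: "\<And>j. 1 \<le> j \<Longrightarrow> 0 \<le> w j" "\<And>j. 0 \<le> g j"
    and sm: "summable (\<lambda>i. w (Suc i) * g (Suc i))"
  shows "L * (\<Sum>j\<in>S. g j) \<le> (\<Sum>i. w (Suc i) * g (Suc i))"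
proof -
  have "L * (\<Sum>j\<in>S. g j) \<le> (\<Sum>j\<in>S. w j * g j)"
    unfolding sum_distrib_left by (intro sum_mono mult_right_mono L nonneg(2))
  also have "\<dots> = (\<Sum>i\<in>(\<lambda>j. j - 1) ` S. w (Suc i) * g (Suc i))"
    by (rule sum.reindex_bij_witness[where i = Suc and j = "\<lambda>j. j - 1"]) (use S(2) in \<open>force+\<close>)
  also have "\<dots> \<le> (\<Sum>i. w (Suc i) * g (Suc i))"
    by (rule sum_le_suminf[OF sm]) (use S(1) nonneg in auto)
  finally show ?thesis .
qed

text \<open>Split at \<open>S\<close>: the bound \<open>B\<close> serves the head and
  \<open>M\<close> the tail. The \<open>M\<close> term may be extended to all indices because it is
  nonnegative.\<close>

lemma weighted_sum_upper:
  fixes w g :: "nat \<Rightarrow> real"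
  assumes S: "finite S" "\<And>j. j \<in> S \<Longrightarrow> 1 \<le> j"
    and B: "\<And>j. 1 \<le> j \<Longrightarrow> w j \<le> B" and M: "\<And>j. 1 \<le> j \<Longrightarrow> j \<notin> S \<Longrightarrow> w j \<le> M" "0 \<le> M"
    and g: "\<And>j. 0 \<le> g j" "summable (\<lambda>i. g (Suc i))"
    and sm: "summable (\<lambda>i. w (Suc i) * g (Suc i))"
  shows "(\<Sum>i. w (Suc i) * g (Suc i)) \<le> B * (\<Sum>j\<in>S. g j) + M * (\<Sum>i. g (Suc i))"
proof -
  let ?T = "(\<lambda>j. j - 1) ` S"
  have T: "i \<in> ?T \<longleftrightarrow> Suc i \<in> S" for i
    using S(2) by force
  have "(\<lambda>i. if i \<in> ?T then B * g (Suc i) else 0) sums (\<Sum>i\<in>?T. B * g (Suc i))"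
    by (rule sums_If_finite_set) (use S(1) in simp)
  then have rhs: "(\<lambda>i. (if i \<in> ?T then B * g (Suc i) else 0) + M * g (Suc i)) sums
      ((\<Sum>i\<in>?T. B * g (Suc i)) + M * (\<Sum>i. g (Suc i)))"
    by (intro sums_add sums_mult summable_sums g(2))
  have "w (Suc i) * g (Suc i) \<le> (if i \<in> ?T then B * g (Suc i) else 0) + M * g (Suc i)" for i
  proof (cases "Suc i \<in> S")
    case True
    then show ?thesis
      using mult_right_mono[OF B[of "Suc i"] g(1)[of "Suc i"]] mult_nonneg_nonneg[OF M(2) g(1)[of "Suc i"]]
      unfolding T by simp
  next
    case False
    then show ?thesis
      using mult_right_mono[OF M(1)[of "Suc i"] g(1)[of "Suc i"]] unfolding T by simp
  qed
  then have "(\<Sum>i. w (Suc i) * g (Suc i)) \<le> (\<Sum>i\<in>?T. B * g (Suc i)) + M * (\<Sum>i. g (Suc i))"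
    using sums_le[OF _ summable_sums[OF sm] rhs] by simp
  also have "(\<Sum>i\<in>?T. B * g (Suc i)) = (\<Sum>j\<in>S. B * g j)"
    by (rule sum.reindex_bij_witness[where i = "\<lambda>j. j - 1" and j = Suc]) (use S(2) in \<open>force+\<close>)
  finally show ?thesis
    by (simp add: sum_distrib_left)
qed

section \<open>From the normalised signal to the energy of the first coefficients\<close>

theorem theorem3:
  fixes \<sigma> r :: real
    and \<kappa>2 :: "nat \<Rightarrow> nat \<Rightarrow> real"
    and \<theta>s :: "nat \<Rightarrow> nat \<Rightarrow> real"
    and c C :: real
  assumes sigma_pos: "\<sigma> > 0"
    and r_bounds: "0 < r" "r < 1/2"
    and kappa_nonneg: "\<And>n j. n \<ge> 1 \<Longrightarrow> j \<ge> 1 \<Longrightarrow> \<kappa>2 n j \<ge> 0"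
    and kappa_summable: "\<And>n. n \<ge> 1 \<Longrightarrow> summable (\<lambda>i. \<kappa>2 n (Suc i))"
    and A1: "\<And>n j. n \<ge> 1 \<Longrightarrow> j \<ge> 1 \<Longrightarrow> \<kappa>2 n (Suc j) \<le> \<kappa>2 n j"
    and A2: "\<exists>C1 C2. C1 > 0 \<and> C2 > 0 \<and> (\<forall>n\<ge>1.
               C1 < \<sigma> powr (-4) * (real n)\<^sup>2 * (\<Sum>i. (\<kappa>2 n (Suc i))\<^sup>2) \<and>
               \<sigma> powr (-4) * (real n)\<^sup>2 * (\<Sum>i. (\<kappa>2 n (Suc i))\<^sup>2) < C2)"
    and A3: "\<exists>c1 c2. c1 > 0 \<and> c2 > 0 \<and> (\<forall>n\<ge>1.
               c1 * real n powr (-2*r) \<le> rho \<kappa>2 n \<and> rho \<kappa>2 n \<le> c2 * real n powr (-2*r))"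
    and A4: "\<exists>C1 lam. C1 > 0 \<and> lam > 1 \<and> (\<forall>\<delta>>0. \<forall>n\<ge>1.
               \<kappa>2 n (nat \<lfloor>(1 + \<delta>) * real (kn \<kappa>2 n)\<rfloor>) < C1 * (1 + \<delta>) powr (-lam) * kappa_n \<kappa>2 n)"
    and A5a: "\<exists>c' C'. c' > 0 \<and> C' > 0 \<and> (\<forall>n\<ge>1.
               c' < \<kappa>2 n 1 / kappa_n \<kappa>2 n \<and> \<kappa>2 n 1 / kappa_n \<kappa>2 n < C')"
    and A5b: "\<forall>c'>1. \<exists>C'>0. \<forall>n\<ge>1.
               \<kappa>2 n (nat \<lfloor>c' * real (kn \<kappa>2 n)\<rfloor>) \<ge> C' * kappa_n \<kappa>2 n"
    and theta_L2: "\<And>n. n \<ge> 1 \<Longrightarrow> summable (\<lambda>i. (\<theta>s n (Suc i))\<^sup>2)"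
    and cC: "0 < c" "c < C"
    and norm_bounds: "\<And>n. n \<ge> 1 \<Longrightarrow>
               c * real n powr (-r) \<le> sqrt (\<Sum>i. (\<theta>s n (Suc i))\<^sup>2) \<and>
               sqrt (\<Sum>i. (\<theta>s n (Suc i))\<^sup>2) \<le> C * real n powr (-r)"
  shows "consistent \<kappa>2 \<sigma> \<theta>s \<longleftrightarrow>
           (\<exists>c1 c2 n0. c1 > 0 \<and> c2 > 0 \<and> (\<forall>n::nat. n > n0 \<longrightarrow>
              (\<Sum>j\<in>{j. 1 \<le> j \<and> real j < c2 * real (kn \<kappa>2 n)}. (\<theta>s n j)\<^sup>2)
                > c1 * real n powr (-2*r)))"
proof -
  define P where "P n = real n powr (- 2 * r)" for n
  define V where "V n = sqrt (2 * (\<Sum>i. (\<kappa>2 n (Suc i))\<^sup>2))" for n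
  define Q where "Q n = (\<Sum>i. \<kappa>2 n (Suc i) * (\<theta>s n (Suc i))\<^sup>2)" for n
  define J where "J b n = {j. 1 \<le> j \<and> real j < b * real (kn \<kappa>2 n)}" for b n
  have P_pos: "0 < P n" if "1 \<le> n" for n
    using that by (simp add: P_def)
  have anti: "\<kappa>2 n j \<le> \<kappa>2 n i" if "1 \<le> n" "1 \<le> i" "i \<le> j" for n i j
    using that(3,2)
  proof (induction rule: dec_induct)
    case (step k)
    then show ?case using A1[OF that(1), of k] by simp
  qed simp
  have Q_summable: "summable (\<lambda>i. \<kappa>2 n (Suc i) * (\<theta>s n (Suc i))\<^sup>2)" if "1 \<le> n" for n
    by (rule summable_comparison_test'[OF summable_mult[OF theta_L2[OF that], of "\<kappa>2 n 1"], of 0])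
       (use kappa_nonneg anti that in \<open>auto intro: mult_right_mono\<close>)
  have J_fin: "finite (J b n)" for b n
    by (rule finite_subset[of _ "{..nat \<lceil>b * real (kn \<kappa>2 n)\<rceil>}"]) (auto simp: J_def, linarith)

  obtain C1 C2 where C12: "C1 > 0" "C2 > 0"
    and A2': "\<And>n. n \<ge> 1 \<Longrightarrow> C1 < \<sigma> powr (-4) * (real n)\<^sup>2 * (\<Sum>i. (\<kappa>2 n (Suc i))\<^sup>2) \<and>
               \<sigma> powr (-4) * (real n)\<^sup>2 * (\<Sum>i. (\<kappa>2 n (Suc i))\<^sup>2) < C2"
    using A2 by blast
  have A2'': "C1 * \<sigma> ^ 4 < (real n)\<^sup>2 * (\<Sum>i. (\<kappa>2 n (Suc i))\<^sup>2)"
    "(real n)\<^sup>2 * (\<Sum>i. (\<kappa>2 n (Suc i))\<^sup>2) < C2 * \<sigma> ^ 4" if "1 \<le> n" for n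
  proof -
    have "\<sigma> powr (-4) = 1 / \<sigma> ^ 4"
      using sigma_pos by (simp add: powr_minus_divide)
    then show "C1 * \<sigma> ^ 4 < (real n)\<^sup>2 * (\<Sum>i. (\<kappa>2 n (Suc i))\<^sup>2)"
      "(real n)\<^sup>2 * (\<Sum>i. (\<kappa>2 n (Suc i))\<^sup>2) < C2 * \<sigma> ^ 4"
      using A2'[OF that] sigma_pos by (simp_all add: pos_less_divide_eq pos_divide_less_eq)
  qed
  have sq_pos: "0 < (\<Sum>i. (\<kappa>2 n (Suc i))\<^sup>2)" if "1 \<le> n" for n
  proof -
    have "0 < C1 * \<sigma> ^ 4" using C12 sigma_pos by simp
    then have "0 < (real n)\<^sup>2 * (\<Sum>i. (\<kappa>2 n (Suc i))\<^sup>2)"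
      using A2''(1)[OF that] by linarith
    then show ?thesis
      using that by (simp add: zero_less_mult_iff)
  qed
  obtain r1 r2 where r12: "r1 > 0" "r2 > 0"
    and rho: "\<And>n. n \<ge> 1 \<Longrightarrow> r1 * P n \<le> rho \<kappa>2 n \<and> rho \<kappa>2 n \<le> r2 * P n"
    using A3 unfolding P_def by blast
  have rho_pos: "0 < rho \<kappa>2 n" if "1 \<le> n" for n
    using rho[OF that] mult_pos_pos[OF r12(1) P_pos[OF that]] by linarith
  have kn_pos: "1 \<le> kn \<kappa>2 n" if "1 \<le> n" for n
    by (rule kn_properties(1)) (use kappa_nonneg kappa_summable rho_pos that in auto)
  obtain e E where eE: "e > 0" "E > 0"
    and A5a': "\<And>n. n \<ge> 1 \<Longrightarrow> e < \<kappa>2 n 1 / kappa_n \<kappa>2 n \<and> \<kappa>2 n 1 / kappa_n \<kappa>2 n < E"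
    using A5a by blast
  \<comment> \<open>Division by zero gives 0, so the positive lower bound in \<open>A5a\<close>
    excludes a vanishing \<open>kappa_n\<close>.\<close>
  have kappa_pos: "0 < kappa_n \<kappa>2 n" if "1 \<le> n" for n
  proof -
    have "kappa_n \<kappa>2 n \<noteq> 0" using A5a'[OF that] eE by auto
    moreover have "0 \<le> kappa_n \<kappa>2 n"
      unfolding kappa_n_def using kappa_nonneg kn_pos that by blast
    ultimately show ?thesis by simp
  qed
  have first_le: "\<kappa>2 n 1 \<le> E * kappa_n \<kappa>2 n" if "1 \<le> n" for n
    using A5a'[OF that] kappa_pos[OF that] by (simp add: pos_divide_less_eq)

  \<comment> \<open>\<open>K\<close> and \<open>L\<close> confine \<open>kappa_n\<close> to the
    order of \<open>1 / (n^2 * P n)\<close>. \<open>K\<close> combines the upper bound in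
    \<open>A2\<close> with the lower bound in \<open>A3\<close>; \<open>L\<close> combines the
    opposite bounds with the comparison of the first weight to \<open>kappa_n\<close> by the factor
    \<open>E\<close>.\<close>
  define K where "K = 2 * C2 * \<sigma> ^ 4 / r1"
  define L where "L = C1 * \<sigma> ^ 4 / (r2 * E)"
  have KL: "K > 0" "L > 0"
    using C12 r12 eE sigma_pos by (simp_all add: K_def L_def)
  have kappa_up: "kappa_n \<kappa>2 n * ((real n)\<^sup>2 * P n) \<le> K" if "1 \<le> n" for n
  proof -
    have "kappa_n \<kappa>2 n * (r1 * P n / 2) \<le> kappa_n \<kappa>2 n * (rho \<kappa>2 n / 2)"
      using rho[OF that] kappa_pos[OF that] by (intro mult_left_mono) auto
    also have "\<dots> \<le> (\<Sum>i. (\<kappa>2 n (Suc i))\<^sup>2)"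
      by (rule kappa_n_le_sum_squares) (use kappa_nonneg anti kappa_summable rho_pos that in auto)
    finally have "(real n)\<^sup>2 * (kappa_n \<kappa>2 n * (r1 * P n / 2)) \<le> (real n)\<^sup>2 * (\<Sum>i. (\<kappa>2 n (Suc i))\<^sup>2)"
      by (rule mult_left_mono) simp
    also have "\<dots> \<le> C2 * \<sigma> ^ 4"
      using A2''(2)[OF that] by simp
    finally show ?thesis
      using r12 by (simp add: K_def pos_le_divide_eq algebra_simps)
  qed
  have first_up: "\<kappa>2 n 1 * ((real n)\<^sup>2 * P n) \<le> E * K" if "1 \<le> n" for n
  proof -
    have "\<kappa>2 n 1 * ((real n)\<^sup>2 * P n) \<le> E * kappa_n \<kappa>2 n * ((real n)\<^sup>2 * P n)"
      using first_le[OF that] P_pos[OF that] by (intro mult_right_mono) auto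
    also have "\<dots> = E * (kappa_n \<kappa>2 n * ((real n)\<^sup>2 * P n))"
      by simp
    also have "\<dots> \<le> E * K"
      using kappa_up[OF that] eE by (intro mult_left_mono) auto
    finally show ?thesis .
  qed
  have kappa_low: "L \<le> kappa_n \<kappa>2 n * ((real n)\<^sup>2 * P n)" if "1 \<le> n" for n
  proof -
    have "(\<Sum>i. (\<kappa>2 n (Suc i))\<^sup>2) \<le> \<kappa>2 n 1 * rho \<kappa>2 n"
      unfolding rho_def
      by (rule sum_squares_le_bound_mult_sum) (use kappa_nonneg anti kappa_summable that in auto)
    also have "\<dots> \<le> (E * kappa_n \<kappa>2 n) * (r2 * P n)"
      using first_le[OF that] rho[OF that] rho_pos[OF that] kappa_pos[OF that] eE
      by (intro mult_mono) auto
    finally have "(real n)\<^sup>2 * (\<Sum>i. (\<kappa>2 n (Suc i))\<^sup>2) \<le> (real n)\<^sup>2 * ((E * kappa_n \<kappa>2 n) * (r2 * P n))"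
      by (rule mult_left_mono) simp
    then have "C1 * \<sigma> ^ 4 \<le> (real n)\<^sup>2 * ((E * kappa_n \<kappa>2 n) * (r2 * P n))"
      using A2''(1)[OF that] by simp
    then show ?thesis
      using r12 eE by (simp add: L_def pos_divide_le_eq algebra_simps)
  qed

  \<comment> \<open>By \<open>A2\<close>, \<open>V n\<close> has exact order \<open>1 / n\<close>;
    \<open>v1\<close> and \<open>v2\<close> are the constants.\<close>
  define v1 where "v1 = sqrt (2 * (C1 * \<sigma> ^ 4))"
  define v2 where "v2 = sqrt (2 * (C2 * \<sigma> ^ 4))"
  have v_pos: "0 < v1" "0 < v2"
    using C12 sigma_pos by (simp_all add: v1_def v2_def)
  have V_bounds: "v1 \<le> real n * V n" "real n * V n \<le> v2" if "1 \<le> n" for n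
  proof -
    have "real n * V n = sqrt (2 * ((real n)\<^sup>2 * (\<Sum>i. (\<kappa>2 n (Suc i))\<^sup>2)))"
      by (simp add: V_def real_sqrt_mult)
    then show "v1 \<le> real n * V n" "real n * V n \<le> v2"
      using A2''[OF that] by (simp_all add: v1_def v2_def)
  qed
  have V_pos: "0 < V n" if "1 \<le> n" for n
    using sq_pos[OF that] by (simp add: V_def)
  \<comment> \<open>The first weight is at most of order \<open>1 / (n^2 * P n)\<close> and
    \<open>V n\<close> has order \<open>1 / n\<close>, so the ratio is at most of order
    \<open>n powr (2 * r - 1)\<close>, which vanishes since \<open>r < 1/2\<close>.\<close>
  have negl: "(\<lambda>n. \<kappa>2 n 1 / V n) \<longlonglongrightarrow> 0"
  proof (rule Lim_null_comparison)
    show "eventually (\<lambda>n. norm (\<kappa>2 n 1 / V n) \<le> E * K / v1 * real n powr (2 * r - 1)) sequentially"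
      using eventually_ge_at_top[of 1]
    proof eventually_elim
      case (elim n)
      have q: "real n powr (2 * r - 1) = 1 / (real n * P n)"
        using elim by (simp add: P_def powr_diff powr_minus field_simps)
      have "\<kappa>2 n 1 / V n = (\<kappa>2 n 1 * ((real n)\<^sup>2 * P n)) / (real n * V n) * (1 / (real n * P n))"
        using elim V_pos[OF elim] P_pos[OF elim] by (simp add: field_simps power2_eq_square)
      also have "\<dots> \<le> E * K / v1 * (1 / (real n * P n))"
        using first_up[OF elim] V_bounds(1)[OF elim] v_pos P_pos[OF elim] KL eE
        by (intro mult_right_mono frac_le) auto
      finally show ?case
        using kappa_nonneg[OF elim, of 1] V_pos[OF elim] by (simp add: q)
    qed
    have "((\<lambda>x. x powr (2 * r - 1)) \<longlongrightarrow> (0::real)) at_top"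
      using r_bounds by (intro tendsto_neg_powr filterlim_ident) auto
    then have "(\<lambda>n. real n powr (2 * r - 1)) \<longlonglongrightarrow> 0"
      by (rule filterlim_compose) (rule filterlim_real_sequentially)
    then show "(\<lambda>n. E * K / v1 * real n powr (2 * r - 1)) \<longlonglongrightarrow> 0"
      by (rule tendsto_mult_right_zero)
  qed
  have Q_nonneg: "0 \<le> Q n" if "1 \<le> n" for n
    unfolding Q_def by (intro suminf_nonneg Q_summable[OF that]) (use kappa_nonneg that in auto)
  \<comment> \<open>As \<open>n * V n\<close> lies between positive constants, the signal is bounded
    below exactly when \<open>n^2 * Q n\<close> is.\<close>
  have sig_eq: "Q n / (\<sigma>\<^sup>2 / n * V n) = (real n)\<^sup>2 * Q n / (\<sigma>\<^sup>2 * (real n * V n))" if "1 \<le> n" for n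
    using that sigma_pos V_pos[OF that] by (simp add: field_simps power2_eq_square)

  have "consistent \<kappa>2 \<sigma> \<theta>s \<longleftrightarrow> (\<exists>s>0. eventually (\<lambda>n. s \<le> Q n / (\<sigma>\<^sup>2 / n * V n)) sequentially)"
    unfolding Q_def V_def
    by (rule consistent_iff_signal_bounded_below)
       (use sigma_pos kappa_nonneg kappa_summable anti sq_pos theta_L2 negl in \<open>auto simp: V_def\<close>)
  also have "\<dots> \<longleftrightarrow> (\<exists>c1 c2 n0. c1 > 0 \<and> c2 > 0 \<and> (\<forall>n>n0. c1 * P n < (\<Sum>j\<in>J c2 n. (\<theta>s n j)\<^sup>2)))"
  proof
    assume "\<exists>s>0. eventually (\<lambda>n. s \<le> Q n / (\<sigma>\<^sup>2 / n * V n)) sequentially"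
    then obtain s n0 where s: "s > 0" and n0: "\<And>n. n \<ge> n0 \<Longrightarrow> s \<le> Q n / (\<sigma>\<^sup>2 / n * V n)"
      by (auto simp: eventually_sequentially)
    obtain D lam where D: "D > 0" "lam > 1" and A4': "\<And>\<delta> n. \<delta> > 0 \<Longrightarrow> n \<ge> 1 \<Longrightarrow>
        \<kappa>2 n (nat \<lfloor>(1 + \<delta>) * real (kn \<kappa>2 n)\<rfloor>) < D * (1 + \<delta>) powr (-lam) * kappa_n \<kappa>2 n"
      using A4 by blast
    define \<eta> where "\<eta> = s * (\<sigma>\<^sup>2 * v1)"
    have \<eta>: "\<eta> > 0" using s sigma_pos v_pos by (simp add: \<eta>_def)
    \<comment> \<open>The indices beyond \<open>b * kn\<close> contribute at most
      \<open>D * K * C^2 * b powr (- lam)\<close> to \<open>n^2 * Q n\<close>, by \<open>A4\<close>,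
      the bound \<open>K\<close> and the norm bound. Choosing \<open>b\<close> large makes this less
      than half of the lower bound \<open>\<eta>\<close> for \<open>n^2 * Q n\<close>.\<close>
    have "((\<lambda>b. D * K * C\<^sup>2 * b powr (- lam)) \<longlongrightarrow> D * K * C\<^sup>2 * 0) at_top"
      using D by (intro tendsto_intros tendsto_neg_powr filterlim_ident) auto
    then have "eventually (\<lambda>b. D * K * C\<^sup>2 * b powr (- lam) < \<eta> / 2) at_top"
      using \<eta> by (intro order_tendstoD(2)) auto
    then have "eventually (\<lambda>b. D * K * C\<^sup>2 * b powr (- lam) < \<eta> / 2 \<and> 1 < b) at_top"
      using eventually_gt_at_top[of 1] by (rule eventually_conj)
    then obtain b :: real where b: "D * K * C\<^sup>2 * b powr (- lam) < \<eta> / 2" "1 < b"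
      using eventually_happens'[OF trivial_limit_at_top_linorder] by blast
    \<comment> \<open>Absorbing the tail leaves at least \<open>\<eta> / 2 * P n\<close> below
      \<open>E * K\<close> times the head energy; halving once more gives the strict
      inequality.\<close>
    have "\<eta> / (4 * E * K) * P n < (\<Sum>j\<in>J b n. (\<theta>s n j)\<^sup>2)" if "n > n0" for n
    proof -
      have n: "1 \<le> n" using that by simp
      let ?S = "\<Sum>j\<in>J b n. (\<theta>s n j)\<^sup>2"
      let ?M = "D * b powr (- lam) * kappa_n \<kappa>2 n"
      let ?T = "\<Sum>i. (\<theta>s n (Suc i))\<^sup>2"
      have "s \<le> (real n)\<^sup>2 * Q n / (\<sigma>\<^sup>2 * (real n * V n))"
        using n0[of n] that sig_eq[OF n] by simp
      also have "\<dots> \<le> (real n)\<^sup>2 * Q n / (\<sigma>\<^sup>2 * v1)"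
        using V_bounds(1)[OF n] v_pos sigma_pos Q_nonneg[OF n] by (intro divide_left_mono) auto
      finally have low: "\<eta> \<le> (real n)\<^sup>2 * Q n"
        using sigma_pos v_pos by (simp add: \<eta>_def pos_le_divide_eq)
      have tail: "\<kappa>2 n j \<le> ?M" if "1 \<le> j" "j \<notin> J b n" for j
      proof -
        have "b * real (kn \<kappa>2 n) \<le> real j"
          using that by (simp add: J_def)
        then have "nat \<lfloor>b * real (kn \<kappa>2 n)\<rfloor> \<le> j"
          by linarith
        \<comment> \<open>Monotonicity of the weights starts at index 1, so the rounded index must
          not be 0.\<close>
        moreover have "1 \<le> nat \<lfloor>b * real (kn \<kappa>2 n)\<rfloor>"
        proof -
          have "1 * 1 \<le> b * real (kn \<kappa>2 n)"
            using b(2) kn_pos[OF n] by (intro mult_mono) auto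
          then show ?thesis by linarith
        qed
        ultimately have "\<kappa>2 n j \<le> \<kappa>2 n (nat \<lfloor>b * real (kn \<kappa>2 n)\<rfloor>)"
          using anti[OF n] by blast
        then show ?thesis
          using A4'[of "b - 1" n] b(2) n by simp
      qed
      have T: "?T \<le> C\<^sup>2 * P n"
      proof -
        have nn: "0 \<le> ?T" by (intro suminf_nonneg theta_L2 n) simp
        have "(sqrt ?T)\<^sup>2 \<le> (C * real n powr (- r))\<^sup>2"
          using norm_bounds[OF n] nn by (intro power_mono) auto
        moreover have "(real n powr (- r))\<^sup>2 = P n"
          using n by (simp add: P_def powr_power mult.commute)
        ultimately show ?thesis
          using nn by (simp add: power_mult_distrib)
      qed
      have "Q n \<le> \<kappa>2 n 1 * ?S + ?M * ?T"
        unfolding Q_def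
        by (rule weighted_sum_upper)
           (use J_fin tail anti n D kappa_pos[OF n] theta_L2 Q_summable in \<open>auto simp: J_def\<close>)
      also have "?M * ?T \<le> ?M * (C\<^sup>2 * P n)"
        using T D kappa_pos[OF n] by (intro mult_left_mono) auto
      \<comment> \<open>Multiplying by \<open>P n\<close> produces the products
        \<open>\<kappa>2 n 1 * (n^2 * P n)\<close> and
        \<open>kappa_n \<kappa>2 n * (n^2 * P n)\<close>, for which constant bounds are
        available.\<close>
      finally have "P n * ((real n)\<^sup>2 * Q n) \<le> P n * ((real n)\<^sup>2 * (\<kappa>2 n 1 * ?S + ?M * (C\<^sup>2 * P n)))"
        using P_pos[OF n] by (intro mult_left_mono) auto
      also have "\<dots> = (\<kappa>2 n 1 * ((real n)\<^sup>2 * P n)) * ?S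
          + D * b powr (- lam) * C\<^sup>2 * P n * (kappa_n \<kappa>2 n * ((real n)\<^sup>2 * P n))"
        by (simp add: algebra_simps)
      also have "\<dots> \<le> E * K * ?S + D * b powr (- lam) * C\<^sup>2 * P n * K"
        using first_up[OF n] kappa_up[OF n] D P_pos[OF n]
        by (intro add_mono mult_right_mono mult_left_mono) (auto intro: sum_nonneg)
      also have "\<dots> = E * K * ?S + (D * K * C\<^sup>2 * b powr (- lam)) * P n"
        by simp
      also have "\<dots> \<le> E * K * ?S + \<eta> / 2 * P n"
        using b(1) P_pos[OF n] by (intro add_left_mono mult_right_mono) auto
      finally have "P n * \<eta> \<le> E * K * ?S + \<eta> / 2 * P n"
        using mult_left_mono[OF low, of "P n"] P_pos[OF n] by linarith
      moreover have "0 < P n * \<eta>" using P_pos[OF n] \<eta> by simp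
      ultimately have "\<eta> * P n < ?S * (4 * E * K)"
        by (simp add: algebra_simps)
      then show ?thesis
        using eE KL by (simp add: pos_divide_less_eq)
    qed
    moreover have "\<eta> / (4 * E * K) > 0" using \<eta> eE KL by simp
    ultimately show "\<exists>c1 c2 n0. c1 > 0 \<and> c2 > 0 \<and> (\<forall>n>n0. c1 * P n < (\<Sum>j\<in>J c2 n. (\<theta>s n j)\<^sup>2))"
      using b(2) by (intro exI[of _ "\<eta> / (4 * E * K)"] exI[of _ b] exI[of _ n0]) auto
  next
    assume "\<exists>c1 c2 n0. c1 > 0 \<and> c2 > 0 \<and> (\<forall>n>n0. c1 * P n < (\<Sum>j\<in>J c2 n. (\<theta>s n j)\<^sup>2))"
    then obtain c1 c2 n0 where c12: "c1 > 0" "c2 > 0"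
      and low: "\<And>n. n > n0 \<Longrightarrow> c1 * P n < (\<Sum>j\<in>J c2 n. (\<theta>s n j)\<^sup>2)" by blast
    \<comment> \<open>\<open>A5b\<close> speaks of factors above 1, so \<open>c2\<close> is enlarged
      if necessary. Every index in \<open>J c2 n\<close> is still at most the rounded
      \<open>b * kn\<close>, where the weight is at least \<open>G * kappa_n\<close>.\<close>
    define b where "b = max c2 2"
    have "1 < b" by (simp add: b_def)
    then obtain G where G: "G > 0" and A5b': "\<And>n. n \<ge> 1 \<Longrightarrow> \<kappa>2 n (nat \<lfloor>b * real (kn \<kappa>2 n)\<rfloor>) \<ge> G * kappa_n \<kappa>2 n"
      using A5b by blast
    have "G * L * c1 / (\<sigma>\<^sup>2 * v2) \<le> Q n / (\<sigma>\<^sup>2 / n * V n)" if "n > n0" for n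
    proof -
      have n: "1 \<le> n" using that by simp
      let ?S = "\<Sum>j\<in>J c2 n. (\<theta>s n j)\<^sup>2"
      have head: "G * kappa_n \<kappa>2 n \<le> \<kappa>2 n j" if "j \<in> J c2 n" for j
      proof -
        have "real j < c2 * real (kn \<kappa>2 n)" "1 \<le> j"
          using that by (auto simp: J_def)
        moreover have "c2 * real (kn \<kappa>2 n) \<le> b * real (kn \<kappa>2 n)"
          by (intro mult_right_mono) (auto simp: b_def)
        ultimately have "j \<le> nat \<lfloor>b * real (kn \<kappa>2 n)\<rfloor>" "1 \<le> j"
          by linarith+
        then show ?thesis
          using anti[OF n, of j] A5b'[OF n] by force
      qed
      have "(G * kappa_n \<kappa>2 n) * (c1 * P n) \<le> (G * kappa_n \<kappa>2 n) * ?S"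
        using low[OF that] G kappa_pos[OF n] by (intro mult_left_mono) auto
      also have "\<dots> \<le> Q n"
        unfolding Q_def
        by (rule weighted_sum_lower)
           (use J_fin head kappa_nonneg n Q_summable in \<open>auto simp: J_def\<close>)
      finally have "(real n)\<^sup>2 * ((G * kappa_n \<kappa>2 n) * (c1 * P n)) \<le> (real n)\<^sup>2 * Q n"
        by (rule mult_left_mono) simp
      moreover have "G * c1 * L \<le> G * c1 * (kappa_n \<kappa>2 n * ((real n)\<^sup>2 * P n))"
        using kappa_low[OF n] G c12 by (intro mult_left_mono) auto
      ultimately have "G * L * c1 \<le> (real n)\<^sup>2 * Q n"
        by (simp add: algebra_simps)
      then have "G * L * c1 / (\<sigma>\<^sup>2 * v2) \<le> (real n)\<^sup>2 * Q n / (\<sigma>\<^sup>2 * (real n * V n))"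
        using V_bounds[OF n] v_pos sigma_pos G KL c12 Q_nonneg[OF n] V_pos[OF n] n
        by (intro frac_le) auto
      then show ?thesis
        using sig_eq[OF n] by simp
    qed
    moreover have "G * L * c1 / (\<sigma>\<^sup>2 * v2) > 0"
      using G KL c12 v_pos sigma_pos by simp
    ultimately show "\<exists>s>0. eventually (\<lambda>n. s \<le> Q n / (\<sigma>\<^sup>2 / n * V n)) sequentially"
      by (intro exI[of _ "G * L * c1 / (\<sigma>\<^sup>2 * v2)"] conjI eventually_mono[OF eventually_gt_at_top[of n0]])
  qed
  finally show ?thesis
    by (simp only: P_def J_def)
qed

end
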